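(* Suppose $(X_A,\sigma_A)$ and $(X_B,\sigma_B)$ are one-sided flow equivalent via a homeomorphism $h:X_A\to X_B$. Let $f\in C(X_B,\mathbb Z)$ and $g\in C(X_A,\mathbb Z)$ be such that $[f]$ is an order unit of $(H^B,H^B_+)$ and $[g]$ is an order unit of $(H^A,H^A_+)$. Then $$\zeta_{A,g}(s)=\zeta_{B,\Psi_{h^{-1}}(g)}(s),\qquad \zeta_{B,f}(s)=\zeta_{A,\Psi_h(f)}(s)$$ (for all $s\in\mathbb C$ with real part large enough that the defining series converge).
   Context: Let $N,M>1$ and let $A$ ($N\times N$) and $B$ ($M\times M$) be irreducible matrices with entries in $\{0,1\}$ which are not permutation matrices. $(X_A,\sigma_A)$ is the one-sided topological Markov shift: $X_A$ is the compact space of sequences $(x_n)_{n\in\mathbb N}$ with $x_n\in\{1,\dots,N\}$, $A(x_n,x_{n+1})=1$ for all $n$, and $\sigma_A((x_n)_n)=(x_{n+1})_n$; similarly $(X_B,\sigma_B)$. $\mathbb Z_+$, $\mathbb R_+$ denote nonnegative integers/reals. $H^A$ is the quotient of $C(X_A,\mathbb Z)$ by $\{u-u\circ\sigma_A: u\in C(X_A,\mathbb Z)\}$, $[f]$ the class of $f$, $H^A_+=\{[f]: f\in C(X_A,\mathbb Z_+)\}$; $[f]\in H^A_+$ is an order unit if for every $[u]\in H^A$ some $n\in\mathbb N$ has $n[f]-[u]\in H^A_+$. For a function $f$ and $m\in\mathbb Z_+$, $f^m(x)=\sum_{i=0}^{m-1}f(\sigma_A^i(x))$. Same for $B$. Suspension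 triplet for $(X_A,\sigma_A)$: $(l,k,b)$ with $l,k\in C(X_A,\mathbb R_+)$, $b\in C(X_A,\mathbb R)$, $c=l-k$ integer-valued with $[c]$ an order unit, and $l-b$, $k-b\circ\sigma_A$ taking values in $\mathbb Z_+$. $S^{l,k}_{A,b}$ is the quotient of $\{(x,r)\in X_A\times\mathbb R: r\ge b(x)\}$ by the equivalence relation generated by $(x,r)\sim(\sigma_A(x),r-c(x))$ for $r\ge l(x)$, with classes $[x,r]$, flow $\phi_{A,t}([x,r])=[x,r+t]$ ($t\in\mathbb R_+$) and base map $b_A(x)=[x,b(x)]$; $S^1_A:=S^{1,0}_{A,0}$ with $s_A(x)=[x,0]$. $(X_A,\sigma_A)$ and $(X_B,\sigma_B)$ are one-sided flow equivalent via $h$ if $h:X_A\to X_B$ is a homeomorphism and there are suspension triplets $(l_1,k_1,b_1)$ for $A$, $(l_2,k_2,b_2)$ for $B$ and continuous $\Phi_1:S^{l_1,k_1}_{A,b_1}\to S^1_B$, $\Phi_2:S^{l_2,k_2}_{B,b_2}\to S^1_A$ intertwining the flows for all $t\in\mathbb R_+$, with $\Phi_1([x,b_1(x)])=s_B(h(x))$ and $\Phi_2([y,b_2(y)])=s_A(h^{-1}(y))$. The maps $\Psi_h,\Psi_{h^{-1}}$: when $h$ is such that there exist continuous $k_1',l_1':X_A\to\mathbb Z_+$ with $\sigma_B^{k_1'(x)}(h(\sigma_A(x)))=\sigma_B^{l_1'(x)}(h(x))$ for all $x$ and continuous $k_2',l_2':X_B\to\mathbb Z_+$ with $\sigma_A^{k_2'(y)}(h^{-1}(\sigma_B(y)))=\sigma_A^{l_2'(y)}(h^{-1}(y))$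 for all $y$ (this is the case when the shifts are one-sided flow equivalent via $h$), set $\Psi_h(f)(x)=\sum_{i=0}^{l_1'(x)-1}f(\sigma_B^i(h(x)))-\sum_{j=0}^{k_1'(x)-1}f(\sigma_B^j(h(\sigma_A(x))))$ for $f\in C(X_B,\mathbb Z)$, and $\Psi_{h^{-1}}(g)(y)=\sum_{i=0}^{l_2'(y)-1}g(\sigma_A^i(h^{-1}(y)))-\sum_{j=0}^{k_2'(y)-1}g(\sigma_A^j(h^{-1}(\sigma_B(y))))$ for $g\in C(X_A,\mathbb Z)$ (these do not depend on the choice of the functions). Dynamical zeta function: for $g\in C(X_A,\mathbb Z)$ with $[g]$ an order unit, $\zeta_{A,g}(s)=\exp\Big\{\sum_{n=1}^\infty\frac1n\sum_{x\in\mathrm{Per}_n(X_A)}\exp\big(-s\sum_{i=0}^{n-1}g(\sigma_A^i(x))\big)\Big\}$, where $\mathrm{Per}_n(X_A)=\{x\in X_A:\sigma_A^n(x)=x\}$, for $s\in\mathbb C$ with sufficiently large real part; similarly $\zeta_{B,f}$. *)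

theory Defs
  imports "HOL-Analysis.Analysis"
begin

text \<open>An N x N matrix is a function nat => nat => nat, with indices in {1..N}.\<close>

fun mpow :: "nat \<Rightarrow> (nat \<Rightarrow> nat \<Rightarrow> nat) \<Rightarrow> nat \<Rightarrow> nat \<Rightarrow> nat \<Rightarrow> nat" where
  "mpow N A 0 i j = (if i = j then 1 else 0)"
| "mpow N A (Suc n) i j = (\<Sum>k\<in>{1..N}. mpow N A n i k * A k j)"

definition zero_one_matrix :: "nat \<Rightarrow> (nat \<Rightarrow> nat \<Rightarrow> nat) \<Rightarrow> bool" where
  "zero_one_matrix N A \<longleftrightarrow> (\<forall>i\<in>{1..N}. \<forall>j\<in>{1..N}. A i j \<in> {0, 1})"

definition irreducible_matrix :: "nat \<Rightarrow> (nat \<Rightarrow> nat \<Rightarrow> nat) \<Rightarrow> bool" where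
  "irreducible_matrix N A \<longleftrightarrow>
     (\<forall>i\<in>{1..N}. \<forall>j\<in>{1..N}. \<exists>n>0. mpow N A n i j > 0)"

definition permutation_matrix :: "nat \<Rightarrow> (nat \<Rightarrow> nat \<Rightarrow> nat) \<Rightarrow> bool" where
  "permutation_matrix N A \<longleftrightarrow> zero_one_matrix N A \<and>
     (\<forall>i\<in>{1..N}. \<exists>!j. j \<in> {1..N} \<and> A i j = 1) \<and>
     (\<forall>j\<in>{1..N}. \<exists>!i. i \<in> {1..N} \<and> A i j = 1)"

definition XA :: "nat \<Rightarrow> (nat \<Rightarrow> nat \<Rightarrow> nat) \<Rightarrow> (nat \<Rightarrow> nat) set" where
  "XA N A = {x. \<forall>n. x n \<in> {1..N} \<and> A (x n) (x (Suc n)) = 1}"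

definition XT :: "nat \<Rightarrow> (nat \<Rightarrow> nat \<Rightarrow> nat) \<Rightarrow> (nat \<Rightarrow> nat) topology" where
  "XT N A = subtopology (product_topology (\<lambda>_. discrete_topology UNIV) UNIV) (XA N A)"

definition shift :: "(nat \<Rightarrow> nat) \<Rightarrow> (nat \<Rightarrow> nat)" where
  "shift x = (\<lambda>n. x (Suc n))"

definition shiftn :: "nat \<Rightarrow> (nat \<Rightarrow> nat) \<Rightarrow> (nat \<Rightarrow> nat)" where
  "shiftn m x = (\<lambda>n. x (n + m))"

text \<open>C(X_A, Z): continuous integer-valued functions (Z discrete); only the values on X_A matter.\<close>
definition Cint :: "nat \<Rightarrow> (nat \<Rightarrow> nat \<Rightarrow> nat) \<Rightarrow> ((nat \<Rightarrow> nat) \<Rightarrow> int) \<Rightarrow> bool" where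
  "Cint N A f \<longleftrightarrow> continuous_map (XT N A) (discrete_topology UNIV) f"

definition Cnat :: "nat \<Rightarrow> (nat \<Rightarrow> nat \<Rightarrow> nat) \<Rightarrow> ((nat \<Rightarrow> nat) \<Rightarrow> nat) \<Rightarrow> bool" where
  "Cnat N A f \<longleftrightarrow> continuous_map (XT N A) (discrete_topology UNIV) f"

definition Creal :: "nat \<Rightarrow> (nat \<Rightarrow> nat \<Rightarrow> nat) \<Rightarrow> ((nat \<Rightarrow> nat) \<Rightarrow> real) \<Rightarrow> bool" where
  "Creal N A f \<longleftrightarrow> continuous_map (XT N A) euclideanreal f"

text \<open>[f] = [g] in H^A: f - g = u - u o sigma_A on X_A for some u in C(X_A,Z).\<close>
definition cohom :: "nat \<Rightarrow> (nat \<Rightarrow> nat \<Rightarrow> nat) \<Rightarrow> ((nat \<Rightarrow> nat) \<Rightarrow> int) \<Rightarrow> ((nat \<Rightarrow> nat) \<Rightarrow> int) \<Rightarrow> bool" where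
  "cohom N A f g \<longleftrightarrow> (\<exists>u. Cint N A u \<and> (\<forall>x\<in>XA N A. f x - g x = u x - u (shift x)))"

definition in_Hplus :: "nat \<Rightarrow> (nat \<Rightarrow> nat \<Rightarrow> nat) \<Rightarrow> ((nat \<Rightarrow> nat) \<Rightarrow> int) \<Rightarrow> bool" where
  "in_Hplus N A f \<longleftrightarrow> (\<exists>p. Cint N A p \<and> (\<forall>x\<in>XA N A. p x \<ge> 0) \<and> cohom N A f p)"

definition order_unit :: "nat \<Rightarrow> (nat \<Rightarrow> nat \<Rightarrow> nat) \<Rightarrow> ((nat \<Rightarrow> nat) \<Rightarrow> int) \<Rightarrow> bool" where
  "order_unit N A f \<longleftrightarrow> Cint N A f \<and> in_Hplus N A f \<and>
     (\<forall>u. Cint N A u \<longrightarrow> (\<exists>n::nat. in_Hplus N A (\<lambda>x. int n * f x - u x)))"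

definition quot_top :: "'a topology \<Rightarrow> ('a \<times> 'a) set \<Rightarrow> 'a set topology" where
  "quot_top T R = topology (\<lambda>U. U \<subseteq> topspace T // R \<and>
       openin T {p \<in> topspace T. R `` {p} \<in> U})"

lemma istopology_quot_top:
  "istopology (\<lambda>U. U \<subseteq> topspace T // R \<and> openin T {p \<in> topspace T. R `` {p} \<in> U})"
  unfolding istopology_def
proof (rule conjI; intro allI impI)
  fix S1 S2 :: "'a set set"
  assume a1: "S1 \<subseteq> topspace T // R \<and> openin T {p \<in> topspace T. R `` {p} \<in> S1}"
    and a2: "S2 \<subseteq> topspace T // R \<and> openin T {p \<in> topspace T. R `` {p} \<in> S2}"
  then show "S1 \<inter> S2 \<subseteq> topspace T // R \<and> openin T {p \<in> topspace T. R `` {p} \<in> S1 \<inter> S2}"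
  proof -
    have "{p \<in> topspace T. R `` {p} \<in> S1 \<inter> S2} =
          {p \<in> topspace T. R `` {p} \<in> S1} \<inter> {p \<in> topspace T. R `` {p} \<in> S2}" by auto
    then show ?thesis using a1 a2 openin_Int by (metis (no_types, lifting) le_infI1)
  qed
next
  fix K :: "'a set set set"
  assume K: "\<forall>U\<in>K. U \<subseteq> topspace T // R \<and> openin T {p \<in> topspace T. R `` {p} \<in> U}"
  have "{p \<in> topspace T. R `` {p} \<in> \<Union>K} = (\<Union>U\<in>K. {p \<in> topspace T. R `` {p} \<in> U})"
    by auto
  then show "\<Union>K \<subseteq> topspace T // R \<and> openin T {p \<in> topspace T. R `` {p} \<in> \<Union>K}"
    using K by auto
qed

definition susp_triplet :: "nat \<Rightarrow> (nat \<Rightarrow> nat \<Rightarrow> nat) \<Rightarrow> ((nat \<Rightarrow> nat) \<Rightarrow> real)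
    \<Rightarrow> ((nat \<Rightarrow> nat) \<Rightarrow> real) \<Rightarrow> ((nat \<Rightarrow> nat) \<Rightarrow> real) \<Rightarrow> bool" where
  "susp_triplet N A l k b \<longleftrightarrow>
     Creal N A l \<and> Creal N A k \<and> Creal N A b \<and>
     (\<forall>x\<in>XA N A. l x \<ge> 0 \<and> k x \<ge> 0) \<and>
     (\<exists>c. order_unit N A c \<and> (\<forall>x\<in>XA N A. l x - k x = of_int (c x))) \<and>
     (\<forall>x\<in>XA N A. \<exists>m::nat. l x - b x = real m) \<and>
     (\<forall>x\<in>XA N A. \<exists>m::nat. k x - b (shift x) = real m)"

definition susp_dom :: "nat \<Rightarrow> (nat \<Rightarrow> nat \<Rightarrow> nat) \<Rightarrow> ((nat \<Rightarrow> nat) \<Rightarrow> real) \<Rightarrow> ((nat \<Rightarrow> nat) \<times> real) set" where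
  "susp_dom N A b = {(x, r). x \<in> XA N A \<and> r \<ge> b x}"

definition susp_gen :: "nat \<Rightarrow> (nat \<Rightarrow> nat \<Rightarrow> nat) \<Rightarrow> ((nat \<Rightarrow> nat) \<Rightarrow> real)
    \<Rightarrow> ((nat \<Rightarrow> nat) \<Rightarrow> real) \<Rightarrow> ((nat \<Rightarrow> nat) \<Rightarrow> real) \<Rightarrow> (((nat \<Rightarrow> nat) \<times> real) \<times> ((nat \<Rightarrow> nat) \<times> real)) set" where
  "susp_gen N A l k b = {((x, r), (shift x, r - (l x - k x))) | x r.
      (x, r) \<in> susp_dom N A b \<and> r \<ge> l x}"

definition susp_rel :: "nat \<Rightarrow> (nat \<Rightarrow> nat \<Rightarrow> nat) \<Rightarrow> ((nat \<Rightarrow> nat) \<Rightarrow> real)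
    \<Rightarrow> ((nat \<Rightarrow> nat) \<Rightarrow> real) \<Rightarrow> ((nat \<Rightarrow> nat) \<Rightarrow> real) \<Rightarrow> (((nat \<Rightarrow> nat) \<times> real) \<times> ((nat \<Rightarrow> nat) \<times> real)) set" where
  "susp_rel N A l k b =
     ((susp_gen N A l k b \<union> (susp_gen N A l k b)\<inverse>)\<^sup>* \<inter> (susp_dom N A b \<times> susp_dom N A b))"

definition susp_top :: "nat \<Rightarrow> (nat \<Rightarrow> nat \<Rightarrow> nat) \<Rightarrow> ((nat \<Rightarrow> nat) \<Rightarrow> real)
    \<Rightarrow> ((nat \<Rightarrow> nat) \<Rightarrow> real) \<Rightarrow> ((nat \<Rightarrow> nat) \<Rightarrow> real) \<Rightarrow> ((nat \<Rightarrow> nat) \<times> real) set topology" where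
  "susp_top N A l k b = quot_top
     (subtopology (prod_topology (XT N A) euclideanreal) (susp_dom N A b)) (susp_rel N A l k b)"

definition susp_space :: "nat \<Rightarrow> (nat \<Rightarrow> nat \<Rightarrow> nat) \<Rightarrow> ((nat \<Rightarrow> nat) \<Rightarrow> real)
    \<Rightarrow> ((nat \<Rightarrow> nat) \<Rightarrow> real) \<Rightarrow> ((nat \<Rightarrow> nat) \<Rightarrow> real) \<Rightarrow> ((nat \<Rightarrow> nat) \<times> real) set set" where
  "susp_space N A l k b = susp_dom N A b // susp_rel N A l k b"

definition susp_cls :: "nat \<Rightarrow> (nat \<Rightarrow> nat \<Rightarrow> nat) \<Rightarrow> ((nat \<Rightarrow> nat) \<Rightarrow> real)
    \<Rightarrow> ((nat \<Rightarrow> nat) \<Rightarrow> real) \<Rightarrow> ((nat \<Rightarrow> nat) \<Rightarrow> real) \<Rightarrow> (nat \<Rightarrow> nat) \<Rightarrow> real \<Rightarrow> ((nat \<Rightarrow> nat) \<times> real) set" where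
  "susp_cls N A l k b x r = susp_rel N A l k b `` {(x, r)}"

definition susp_flow :: "nat \<Rightarrow> (nat \<Rightarrow> nat \<Rightarrow> nat) \<Rightarrow> ((nat \<Rightarrow> nat) \<Rightarrow> real)
    \<Rightarrow> ((nat \<Rightarrow> nat) \<Rightarrow> real) \<Rightarrow> ((nat \<Rightarrow> nat) \<Rightarrow> real) \<Rightarrow> real
    \<Rightarrow> ((nat \<Rightarrow> nat) \<times> real) set \<Rightarrow> ((nat \<Rightarrow> nat) \<times> real) set" where
  "susp_flow N A l k b t P = susp_rel N A l k b `` ((\<lambda>(x, r). (x, r + t)) ` P)"

definition flow_equiv_via ::
  "nat \<Rightarrow> (nat \<Rightarrow> nat \<Rightarrow> nat) \<Rightarrow> nat \<Rightarrow> (nat \<Rightarrow> nat \<Rightarrow> nat) \<Rightarrow> ((nat \<Rightarrow> nat) \<Rightarrow> (nat \<Rightarrow> nat)) \<Rightarrow> bool" where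
  "flow_equiv_via N A M B h \<longleftrightarrow>
     homeomorphic_map (XT N A) (XT M B) h \<and>
     (\<exists>l1 k1 b1 l2 k2 b2 \<Phi>1 \<Phi>2.
        susp_triplet N A l1 k1 b1 \<and> susp_triplet M B l2 k2 b2 \<and>
        continuous_map (susp_top N A l1 k1 b1) (susp_top M B (\<lambda>_. 1) (\<lambda>_. 0) (\<lambda>_. 0)) \<Phi>1 \<and>
        continuous_map (susp_top M B l2 k2 b2) (susp_top N A (\<lambda>_. 1) (\<lambda>_. 0) (\<lambda>_. 0)) \<Phi>2 \<and>
        (\<forall>t\<ge>0. \<forall>P\<in>susp_space N A l1 k1 b1.
           \<Phi>1 (susp_flow N A l1 k1 b1 t P) = susp_flow M B (\<lambda>_. 1) (\<lambda>_. 0) (\<lambda>_. 0) t (\<Phi>1 P)) \<and>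
        (\<forall>t\<ge>0. \<forall>P\<in>susp_space M B l2 k2 b2.
           \<Phi>2 (susp_flow M B l2 k2 b2 t P) = susp_flow N A (\<lambda>_. 1) (\<lambda>_. 0) (\<lambda>_. 0) t (\<Phi>2 P)) \<and>
        (\<forall>x\<in>XA N A. \<Phi>1 (susp_cls N A l1 k1 b1 x (b1 x))
            = susp_cls M B (\<lambda>_. 1) (\<lambda>_. 0) (\<lambda>_. 0) (h x) 0) \<and>
        (\<forall>y\<in>XA M B. \<Phi>2 (susp_cls M B l2 k2 b2 y (b2 y))
            = susp_cls N A (\<lambda>_. 1) (\<lambda>_. 0) (\<lambda>_. 0) (inv_into (XA N A) h y) 0))"

text \<open>Psi_h for h : X_A -> X_B, applied to f in C(X_B,Z). The pair (k',l') is chosen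
  by Hilbert choice among those with the required property (the value does not depend on the choice).\<close>
definition Psi :: "nat \<Rightarrow> (nat \<Rightarrow> nat \<Rightarrow> nat) \<Rightarrow> nat \<Rightarrow> (nat \<Rightarrow> nat \<Rightarrow> nat)
    \<Rightarrow> ((nat \<Rightarrow> nat) \<Rightarrow> (nat \<Rightarrow> nat)) \<Rightarrow> ((nat \<Rightarrow> nat) \<Rightarrow> int) \<Rightarrow> (nat \<Rightarrow> nat) \<Rightarrow> int" where
  "Psi N A M B h f x =
     (let kl = (SOME kl. Cnat N A (fst kl) \<and> Cnat N A (snd kl) \<and>
                  (\<forall>x\<in>XA N A. shiftn (fst kl x) (h (shift x)) = shiftn (snd kl x) (h x)))
      in (\<Sum>i<snd kl x. f (shiftn i (h x))) - (\<Sum>j<fst kl x. f (shiftn j (h (shift x)))))"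

definition Per :: "nat \<Rightarrow> (nat \<Rightarrow> nat \<Rightarrow> nat) \<Rightarrow> nat \<Rightarrow> (nat \<Rightarrow> nat) set" where
  "Per N A n = {x \<in> XA N A. shiftn n x = x}"

definition birkhoff :: "((nat \<Rightarrow> nat) \<Rightarrow> int) \<Rightarrow> nat \<Rightarrow> (nat \<Rightarrow> nat) \<Rightarrow> int" where
  "birkhoff g n x = (\<Sum>i<n. g (shiftn i x))"

definition zeta_term :: "nat \<Rightarrow> (nat \<Rightarrow> nat \<Rightarrow> nat) \<Rightarrow> ((nat \<Rightarrow> nat) \<Rightarrow> int) \<Rightarrow> complex \<Rightarrow> nat \<Rightarrow> complex" where
  "zeta_term N A g s m = (let n = Suc m in
     (1 / of_nat n) * (\<Sum>x\<in>Per N A n. exp (- s * of_int (birkhoff g n x))))"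

definition zeta :: "nat \<Rightarrow> (nat \<Rightarrow> nat \<Rightarrow> nat) \<Rightarrow> ((nat \<Rightarrow> nat) \<Rightarrow> int) \<Rightarrow> complex \<Rightarrow> complex" where
  "zeta N A g s = exp (\<Sum>m. zeta_term N A g s m)"

end

theory Submission
  imports Defs
begin

text \<open>
  The series in \<open>zeta\<close> can be rewritten as a sum over pairs of a periodic orbit \<open>Q\<close> and a repetition
  number \<open>j\<close> of \<open>exp (- s j w(Q)) / j\<close>, where \<open>w(Q)\<close> is the sum of the weight over \<open>Q\<close>. It therefore
  suffices to match the periodic orbits of the two shifts so that weights correspond.

  The intertwining flow map yields continuous exponents with
  \<open>\<sigma>\<^sup>k (h (\<sigma> x)) = \<sigma>\<^sup>l (h x)\<close>, and \<open>l - k\<close> has positive sum over every periodic orbit because it differs by a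
  real coboundary from an order unit. Hence \<open>h\<close> maps a periodic point \<open>x\<close> to an eventually periodic
  point, and the sum of \<open>\<Psi>\<^sub>h(f)\<close> over the orbit of \<open>x\<close> telescopes to a sum of \<open>f\<close> along \<open>W\<close> steps of the
  limiting periodic orbit, where \<open>W\<close> is the sum of \<open>l - k\<close>. As the shift spaces have no isolated points,
  exponents in such relations are unique by continuity; so the cocycles of \<open>h\<close> and its inverse compose
  to 1, which forces \<open>W\<close> to be the least period.
\<close>

no_notation Infinite_Set_Sum.abs_summable_on (infix \<open>abs'_summable'_on\<close> 50)

section \<open>Shifts, Birkhoff sums and locally constant functions\<close>

lemma shiftn_0 [simp]: "shiftn 0 x = x"
  by (simp add: shiftn_def)

lemma shiftn_shiftn [simp]: "shiftn m (shiftn n x) = shiftn (m + n) x"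
  by (auto simp: shiftn_def add.assoc)

lemma shift_eq_shiftn: "shift x = shiftn 1 x"
  by (auto simp: shiftn_def shift_def)

lemma shiftn_Suc: "shiftn (Suc n) x = shift (shiftn n x)"
  by (simp add: shift_eq_shiftn)

lemma shift_in_XA: "x \<in> XA N A \<Longrightarrow> shift x \<in> XA N A"
  by (auto simp: XA_def shift_def)

lemma shiftn_in_XA: "x \<in> XA N A \<Longrightarrow> shiftn n x \<in> XA N A"
  by (auto simp: XA_def shiftn_def)

lemma topspace_XT [simp]: "topspace (XT N A) = XA N A"
  by (auto simp: XT_def)

lemma birkhoff_0 [simp]: "birkhoff g 0 x = 0"
  by (simp add: birkhoff_def)

lemma birkhoff_Suc: "birkhoff g (Suc n) x = birkhoff g n x + g (shiftn n x)"
  by (simp add: birkhoff_def)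

lemma birkhoff_add: "birkhoff g (m + n) x = birkhoff g m x + birkhoff g n (shiftn m x)"
  by (induction n) (simp_all add: birkhoff_Suc add.commute)

lemma birkhoff_one [simp]: "birkhoff (\<lambda>_. 1) n x = int n"
  by (simp add: birkhoff_def)

lemma shiftn_mult_periodic: "shiftn p x = x \<Longrightarrow> shiftn (r * p) x = x"
proof (induction r)
  case (Suc r)
  have "shiftn (Suc r * p) x = shiftn (r * p) (shiftn p x)"
    by (simp add: algebra_simps)
  then show ?case using Suc by simp
qed simp

lemma birkhoff_mult_periodic:
  assumes "shiftn p x = x"
  shows "birkhoff g (r * p) x = int r * birkhoff g p x"
proof (induction r)
  case (Suc r)
  have "birkhoff g (Suc r * p) x = birkhoff g (r * p) x + birkhoff g p (shiftn (r * p) x)"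
    using birkhoff_add[of g "r * p" p x] by (simp add: add.commute)
  then show ?case
    using Suc shiftn_mult_periodic[OF assms] by (simp add: distrib_right)
qed simp

lemma birkhoff_shift_invariant:
  assumes "shiftn p x = x"
  shows "birkhoff g p (shiftn i x) = birkhoff g p x"
proof -
  have "birkhoff g (p + i) x = birkhoff g (i + p) x"
    by (simp add: add.commute)
  then show ?thesis
    using birkhoff_add[of g p i x] birkhoff_add[of g i p x] assms by simp
qed

lemma birkhoff_cong:
  assumes "\<And>z. z \<in> XA N A \<Longrightarrow> f z = g z" and "x \<in> XA N A"
  shows "birkhoff f n x = birkhoff g n x"
  using assms shiftn_in_XA by (auto simp: birkhoff_def intro!: sum.cong)

section \<open>Cylinder sets and locally constant maps\<close>

definition agree :: "nat \<Rightarrow> (nat \<Rightarrow> nat) \<Rightarrow> (nat \<Rightarrow> nat) \<Rightarrow> bool" where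
  "agree n x z \<longleftrightarrow> (\<forall>i<n. z i = x i)"

lemma agree_mono: "agree n x z \<Longrightarrow> m \<le> n \<Longrightarrow> agree m x z"
  by (auto simp: agree_def)

text \<open>Continuity into a discrete space, phrased with cylinders so that sums and compositions
  need no reference to a topology.\<close>

definition lc :: "(nat \<Rightarrow> nat) set \<Rightarrow> ((nat \<Rightarrow> nat) \<Rightarrow> 'b) \<Rightarrow> bool" where
  "lc X f \<longleftrightarrow> (\<forall>x\<in>X. \<exists>n. \<forall>z\<in>X. agree n x z \<longrightarrow> f z = f x)"

lemma lcE:
  assumes "lc X f" "x \<in> X"
  obtains n where "\<And>z. z \<in> X \<Longrightarrow> agree n x z \<Longrightarrow> f z = f x"
  using assms unfolding lc_def by blast

lemma lc_const: "lc X (\<lambda>_. c)"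
  by (simp add: lc_def)

lemma lc_coordinate: "lc X (\<lambda>x. x i)"
  unfolding lc_def agree_def by (meson lessI)

lemma lc_pair:
  assumes f: "lc X f" and g: "lc X g"
  shows "lc X (\<lambda>x. (f x, g x))"
  unfolding lc_def
proof
  fix x assume x: "x \<in> X"
  obtain m where m: "\<And>z. z \<in> X \<Longrightarrow> agree m x z \<Longrightarrow> f z = f x" using lcE[OF f x] by blast
  obtain n where n: "\<And>z. z \<in> X \<Longrightarrow> agree n x z \<Longrightarrow> g z = g x" using lcE[OF g x] by blast
  show "\<exists>n. \<forall>z\<in>X. agree n x z \<longrightarrow> (f z, g z) = (f x, g x)"
  proof (intro exI ballI impI)
    fix z assume "z \<in> X" and "agree (max m n) x z"
    then show "(f z, g z) = (f x, g x)"
      using m[of z] n[of z] agree_mono[of "max m n" x z] by simp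
  qed
qed

lemma lc_map: "lc X f \<Longrightarrow> lc X (\<lambda>x. F (f x))"
  unfolding lc_def by metis

lemma lc_map2: "lc X f \<Longrightarrow> lc X g \<Longrightarrow> lc X (\<lambda>x. F (f x) (g x))"
  using lc_map[OF lc_pair, of X f g "\<lambda>p. F (fst p) (snd p)"] by simp

text \<open>Near each point the index \<open>m\<close> is constant, so \<open>F\<close> is used
  there with a fixed index. This handles sums whose length depends on the point.\<close>

lemma lc_apply:
  assumes m: "lc X m" and F: "\<And>c. lc X (F c)"
  shows "lc X (\<lambda>x. F (m x) x)"
  unfolding lc_def
proof
  fix x assume x: "x \<in> X"
  obtain n where n: "\<And>z. z \<in> X \<Longrightarrow> agree n x z \<Longrightarrow> (m z, F (m x) z) = (m x, F (m x) x)"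
    using lcE[OF lc_pair[OF m F[of "m x"]] x] by blast
  then show "\<exists>n. \<forall>z\<in>X. agree n x z \<longrightarrow> F (m z) z = F (m x) x"
    by (intro exI[of _ n]) auto
qed

lemma lc_sum:
  fixes F :: "nat \<Rightarrow> (nat \<Rightarrow> nat) \<Rightarrow> 'b::comm_monoid_add"
  assumes F: "\<And>i. lc X (F i)"
  shows "lc X (\<lambda>x. \<Sum>i<c. F i x)"
  by (induction c) (auto intro: lc_const lc_map2 F)

definition lc_to :: "(nat \<Rightarrow> nat) set \<Rightarrow> (nat \<Rightarrow> nat) set \<Rightarrow> ((nat \<Rightarrow> nat) \<Rightarrow> (nat \<Rightarrow> nat)) \<Rightarrow> bool" where
  "lc_to X Y T \<longleftrightarrow> T ` X \<subseteq> Y \<and> (\<forall>i. lc X (\<lambda>x. T x i))"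

lemma lc_to_agree:
  assumes "lc_to X Y T" "x \<in> X"
  shows "\<exists>m. \<forall>z\<in>X. agree m x z \<longrightarrow> agree n (T x) (T z)"
proof (induction n)
  case 0
  then show ?case by (simp add: agree_def)
next
  case (Suc n)
  then obtain m where m: "\<And>z. z \<in> X \<Longrightarrow> agree m x z \<Longrightarrow> agree n (T x) (T z)" by blast
  have "lc X (\<lambda>x. T x n)" using assms by (simp add: lc_to_def)
  from lcE[OF this assms(2)] obtain r where r: "\<And>z. z \<in> X \<Longrightarrow> agree r x z \<Longrightarrow> T z n = T x n"
    by blast
  have "agree (Suc n) (T x) (T z)" if "z \<in> X" "agree (max m r) x z" for z
    using m[OF that(1)] r[OF that(1)] agree_mono[OF that(2), of m] agree_mono[OF that(2), of r]
    by (auto simp: agree_def less_Suc_eq)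
  then show ?case by blast
qed

lemma lc_comp:
  assumes f: "lc Y f" and T: "lc_to X Y T"
  shows "lc X (\<lambda>x. f (T x))"
  unfolding lc_def
proof
  fix x assume x: "x \<in> X"
  then have "T x \<in> Y" and TY: "\<And>z. z \<in> X \<Longrightarrow> T z \<in> Y" using T by (auto simp: lc_to_def)
  then obtain n where n: "\<And>z. z \<in> Y \<Longrightarrow> agree n (T x) z \<Longrightarrow> f z = f (T x)" using lcE[OF f] by blast
  obtain m where "\<forall>z\<in>X. agree m x z \<longrightarrow> agree n (T x) (T z)" using lc_to_agree[OF T x] by blast
  then show "\<exists>n. \<forall>z\<in>X. agree n x z \<longrightarrow> f (T z) = f (T x)" using n TY by blast
qed

lemma lc_to_comp: "lc_to X Y S \<Longrightarrow> lc_to Y Z T \<Longrightarrow> lc_to X Z (\<lambda>x. T (S x))"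
proof -
  assume S: "lc_to X Y S" and T: "lc_to Y Z T"
  have "lc X (\<lambda>x. T (S x) i)" for i
    using T by (intro lc_comp[of Y "\<lambda>y. T y i", OF _ S]) (simp add: lc_to_def)
  then show ?thesis using S T unfolding lc_to_def by blast
qed

lemma lc_to_shiftn: "lc_to (XA N A) (XA N A) (shiftn n)"
  using shiftn_in_XA lc_coordinate by (auto simp: lc_to_def shiftn_def)

lemma lc_to_shift: "lc_to (XA N A) (XA N A) shift"
  using lc_to_shiftn[of N A 1] by (simp add: shift_eq_shiftn[abs_def])

text \<open>A basic open set of the product topology restricts only finitely many coordinates, so
  every neighbourhood contains a cylinder.\<close>

lemma lc_if_continuous:
  assumes "continuous_map (XT N A) (discrete_topology UNIV) f"
  shows "lc (XA N A) f"
  unfolding lc_def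
proof
  fix x assume x: "x \<in> XA N A"
  have "openin (XT N A) {z \<in> topspace (XT N A). f z \<in> {f x}}"
    by (rule openin_continuous_map_preimage[OF assms]) simp
  then obtain U where U: "openin (product_topology (\<lambda>_. discrete_topology UNIV) UNIV) U"
    and eq: "{z \<in> XA N A. f z = f x} = U \<inter> XA N A"
    unfolding XT_def openin_subtopology by auto
  have "x \<in> U" using eq x by blast
  then obtain V where V: "finite {i. V i \<noteq> (UNIV::nat set)}" "x \<in> Pi\<^sub>E UNIV V" "Pi\<^sub>E UNIV V \<subseteq> U"
    using U unfolding openin_product_topology_alt by auto
  \<comment> \<open>The length \<open>n\<close> exceeds every restricted coordinate; the inserted 0
    covers the case that none is restricted.\<close>
  define n where "n = Suc (Max (insert 0 {i. V i \<noteq> UNIV}))"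
  have n: "i < n" if "V i \<noteq> UNIV" for i
    using that V(1) by (auto simp: n_def less_Suc_eq_le intro!: Max_ge)
  have "f z = f x" if z: "z \<in> XA N A" "agree n x z" for z
  proof -
    have "z i \<in> V i" for i
      using n[of i] z(2) V(2) by (cases "V i = UNIV") (auto simp: agree_def PiE_def Pi_def)
    then have "z \<in> U" using V(3) by (auto simp: PiE_def)
    then show ?thesis using eq z by blast
  qed
  then show "\<exists>n. \<forall>z\<in>XA N A. agree n x z \<longrightarrow> f z = f x" by blast
qed

lemma lc_to_if_continuous:
  assumes "continuous_map (XT N A) (XT M B) h"
  shows "lc_to (XA N A) (XA M B) h"
proof -
  have "continuous_map (XT N A) (discrete_topology UNIV) (\<lambda>x. h x i)" for i
    using assms
    unfolding XT_def continuous_map_in_subtopology continuous_map_componentwise_UNIV by blast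
  moreover have "h ` XA N A \<subseteq> XA M B"
    using assms by (metis continuous_map_image_subset_topspace topspace_XT)
  ultimately show ?thesis by (simp add: lc_to_def lc_if_continuous)
qed

section \<open>Uniqueness of exponents in spaces without isolated points\<close>

definition perfect_seqs :: "(nat \<Rightarrow> nat) set \<Rightarrow> bool" where
  "perfect_seqs X \<longleftrightarrow> (\<forall>x\<in>X. \<forall>n. \<exists>z\<in>X. z \<noteq> x \<and> agree n x z)"

text \<open>If two exponents differed at a point, every nearby point would be eventually periodic
  with a common preperiod and period, hence determined by finitely many coordinates.\<close>

lemma exponents_not_less:
  assumes perf: "perfect_seqs X" and p: "lc X p" and q: "lc X q"
    and eq: "\<And>x. x \<in> X \<Longrightarrow> shiftn (p x) x = shiftn (q x) x" and x: "x \<in> X"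
  shows "\<not> p x < q x"
proof
  assume less: "p x < q x"
  obtain n where n: "\<And>z. z \<in> X \<Longrightarrow> agree n x z \<Longrightarrow> (p z, q z) = (p x, q x)"
    using lcE[OF lc_pair[OF p q] x] by blast
  obtain z where z: "z \<in> X" "z \<noteq> x" "agree (max n (q x)) x z"
    using perf x unfolding perfect_seqs_def by blast
  have pq: "p z = p x" "q z = q x" using n[OF z(1)] agree_mono[OF z(3)] by auto
  \<comment> \<open>From coordinate \<open>q x\<close> on, each entry repeats the one
    \<open>q x - p x\<close> places earlier, so the first \<open>q x\<close> entries determine the
    point.\<close>
  have rec: "w i = w (i - (q x - p x))" if "shiftn (p x) w = shiftn (q x) w" "q x \<le> i" for w i
    using fun_cong[OF that(1), of "i - q x"] that(2) less by (simp add: shiftn_def)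
  have "z i = x i" for i
  proof (induction i rule: less_induct)
    case (less i)
    show ?case
    proof (cases "i < q x")
      case True
      then show ?thesis using z(3) by (simp add: agree_def)
    next
      case False
      then have "z i = z (i - (q x - p x))" "x i = x (i - (q x - p x))"
        using rec eq[OF z(1)] eq[OF x] pq by auto
      then show ?thesis using less[of "i - (q x - p x)"] False \<open>p x < q x\<close> by simp
    qed
  qed
  then show False using z(2) by blast
qed

lemma exponents_unique:
  assumes "perfect_seqs X" "lc X p" "lc X q"
    and "\<And>x. x \<in> X \<Longrightarrow> shiftn (p x) x = shiftn (q x) x" and "x \<in> X"
  shows "p x = q x"
  using exponents_not_less[OF assms] exponents_not_less[OF assms(1,3,2) assms(4)[symmetric] assms(5)]
  by simp

section \<open>Irreducible non-permutation matrices have perfect shift spaces\<close>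

lemma mpow_last_step:
  assumes "mpow N A (Suc n) i j > 0"
  obtains k where "k \<in> {1..N}" "mpow N A n i k > 0" "A k j > 0"
proof -
  have "\<exists>k\<in>{1..N}. mpow N A n i k * A k j \<noteq> 0"
    using assms by (metis (no_types, lifting) mpow.simps(2) not_gr_zero sum.neutral)
  then show ?thesis using that by auto
qed

lemma prepend_in_XA:
  assumes "z \<in> XA N A" "i \<in> {1..N}" "A i (z 0) = 1"
  shows "case_nat i z \<in> XA N A"
  using assms by (auto simp: XA_def split: nat.splits)

text \<open>At the seam, \<open>z 0 = x n\<close> turns the transition into one of \<open>x\<close>;
  all others lie within one of the two points.\<close>

lemma splice_in_XA:
  assumes "x \<in> XA N A" "z \<in> XA N A" "z 0 = x n"
  shows "(\<lambda>i. if i < n then x i else z (i - n)) \<in> XA N A"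
proof -
  have "A (x i) (z (Suc i - n)) = 1" if "i < n" "\<not> Suc i < n" for i
  proof -
    have "n = Suc i" using that by simp
    then show ?thesis using assms by (simp add: XA_def)
  qed
  moreover have "A (z (i - n)) (z (Suc i - n)) = 1" if "\<not> i < n" for i
    using that assms(2) by (simp add: XA_def Suc_diff_le)
  ultimately show ?thesis using assms by (auto simp: XA_def)
qed

context
  fixes N :: nat and A :: "nat \<Rightarrow> nat \<Rightarrow> nat"
  assumes zero_one: "zero_one_matrix N A" and irred: "irreducible_matrix N A"
begin

lemma entry_eq_one: "i \<in> {1..N} \<Longrightarrow> j \<in> {1..N} \<Longrightarrow> A i j > 0 \<Longrightarrow> A i j = 1"
  using zero_one unfolding zero_one_matrix_def by (metis empty_iff insert_iff less_irrefl)

text \<open>A positive entry of a matrix power stands for an admissible path. Since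
  \<open>mpow\<close> multiplies on the right, the path is read off backwards and prepended to
  \<open>z\<close> one symbol at a time.\<close>

lemma path_to_point:
  assumes "mpow N A n i (z 0) > 0" "z \<in> XA N A"
  shows "\<exists>w\<in>XA N A. w 0 = i \<and> shiftn n w = z"
  using assms
proof (induction n arbitrary: z)
  case 0
  then show ?case by (auto split: if_splits)
next
  case (Suc n)
  obtain k where k: "k \<in> {1..N}" "mpow N A n i k > 0" "A k (z 0) > 0"
    using mpow_last_step[OF Suc.prems(1)] .
  have "z 0 \<in> {1..N}" using Suc.prems(2) by (simp add: XA_def)
  then have "case_nat k z \<in> XA N A"
    using prepend_in_XA entry_eq_one k Suc.prems(2) by simp
  then obtain w where w: "w \<in> XA N A" "w 0 = i" "shiftn n w = case_nat k z"
    using Suc.IH[of "case_nat k z"] k by auto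
  have "shiftn (Suc n) w = z"
    unfolding shiftn_Suc w(3) by (auto simp: shift_def)
  then show ?case using w by blast
qed

lemma column_nonzero:
  assumes "j \<in> {1..N}"
  shows "\<exists>i\<in>{1..N}. A i j = 1"
proof -
  obtain n where "n > 0" "mpow N A n j j > 0" using irred assms unfolding irreducible_matrix_def by blast
  then obtain m where "mpow N A (Suc m) j j > 0" by (cases n) auto
  then obtain k where "k \<in> {1..N}" "A k j > 0" by (metis mpow_last_step)
  then show ?thesis using entry_eq_one assms by blast
qed

text \<open>The recursion of \<open>mpow\<close> exposes the last edge of a path; the first edge is
  reached by induction over all end points \<open>j\<close>.\<close>

lemma mpow_first_step:
  assumes "mpow N A (Suc n) i j > 0" "j \<in> {1..N}" "i \<in> {1..N}"
  shows "\<exists>k\<in>{1..N}. A i k = 1"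
  using assms
proof (induction n arbitrary: j)
  case 0
  obtain k where "k \<in> {1..N}" "mpow N A 0 i k > 0" "A k j > 0" using mpow_last_step[OF 0(1)] .
  moreover from this have "i = k" by (simp split: if_splits)
  ultimately show ?case using 0 entry_eq_one by blast
next
  case (Suc n)
  then show ?case by (metis mpow_last_step)
qed

lemma row_nonzero:
  assumes "i \<in> {1..N}"
  shows "\<exists>j\<in>{1..N}. A i j = 1"
proof -
  obtain n where "n > 0" "mpow N A n i i > 0" using irred assms unfolding irreducible_matrix_def by blast
  then show ?thesis using mpow_first_step assms by (cases n) auto
qed

lemma point_from:
  assumes "i \<in> {1..N}"
  shows "\<exists>x\<in>XA N A. x 0 = i"
proof -
  obtain s where s: "\<And>j. j \<in> {1..N} \<Longrightarrow> s j \<in> {1..N} \<and> A j (s j) = 1"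
    using row_nonzero by metis
  have "(s ^^ n) i \<in> {1..N}" for n using assms s by (induction n) auto
  then have "(\<lambda>n. (s ^^ n) i) \<in> XA N A" using s by (simp add: XA_def)
  then show ?thesis by (intro bexI[of _ "\<lambda>n. (s ^^ n) i"]) auto
qed

text \<open>If no row branched, each symbol would have exactly one successor. As no column vanishes,
  the successor map would be onto, hence injective by finiteness, and \<open>A\<close> would be a
  permutation matrix.\<close>

lemma branching_row:
  assumes "\<not> permutation_matrix N A"
  obtains i j j' where "i \<in> {1..N}" "j \<in> {1..N}" "j' \<in> {1..N}" "j \<noteq> j'" "A i j = 1" "A i j' = 1"
proof -
  have "\<exists>i\<in>{1..N}. \<exists>j\<in>{1..N}. \<exists>j'\<in>{1..N}. j \<noteq> j' \<and> A i j = 1 \<and> A i j' = 1"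
  proof (rule ccontr)
    assume no: "\<not> ?thesis"
    obtain s where s: "\<And>i. i \<in> {1..N} \<Longrightarrow> s i \<in> {1..N} \<and> A i (s i) = 1"
      using row_nonzero by metis
    have uniq: "j = s i" if "i \<in> {1..N}" "j \<in> {1..N}" "A i j = 1" for i j
      using no s that by blast
    have "{1..N} \<subseteq> s ` {1..N}" using column_nonzero uniq by blast
    moreover have "s ` {1..N} \<subseteq> {1..N}" using s by blast
    ultimately have "inj_on s {1..N}" by (metis finite_atLeastAtMost eq_card_imp_inj_on subset_antisym)
    have "\<exists>!j. j \<in> {1..N} \<and> A i j = 1" if "i \<in> {1..N}" for i
      using s uniq that by metis
    moreover have "\<exists>!i. i \<in> {1..N} \<and> A i j = 1" if j: "j \<in> {1..N}" for j
      using column_nonzero[OF j] uniq j \<open>inj_on s {1..N}\<close> by (metis inj_onD)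
    ultimately show False using assms zero_one by (simp add: permutation_matrix_def)
  qed
  then show ?thesis using that by blast
qed

text \<open>Irreducibility leads from \<open>x n\<close> to a branching symbol. Its two successors
  give two points that agree with \<open>x\<close> before \<open>n\<close> and differ from each
  other, so at least one of them differs from \<open>x\<close>.\<close>

lemma perfect_XA:
  assumes "\<not> permutation_matrix N A"
  shows "perfect_seqs (XA N A)"
  unfolding perfect_seqs_def
proof (intro ballI allI)
  fix x n assume x: "x \<in> XA N A"
  obtain i j j' where ij: "i \<in> {1..N}" "j \<in> {1..N}" "j' \<in> {1..N}" "j \<noteq> j'" "A i j = 1" "A i j' = 1"
    using branching_row[OF assms] .
  obtain m where m: "mpow N A m (x n) i > 0"
    using irred x ij(1) by (fastforce simp: irreducible_matrix_def XA_def)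
  have ext: "\<exists>z\<in>XA N A. agree n x z \<and> z (n + m + 1) = r" if r: "r \<in> {1..N}" "A i r = 1" for r
  proof -
    obtain u where u: "u \<in> XA N A" "u 0 = r" using point_from r by blast
    have "case_nat i u \<in> XA N A" using prepend_in_XA u r ij(1) by simp
    then obtain w where w: "w \<in> XA N A" "w 0 = x n" "shiftn m w = case_nat i u"
      using path_to_point[of m "x n" "case_nat i u"] m by auto
    have "w (m + 1) = r" using fun_cong[OF w(3), of 1] u by (simp add: shiftn_def)
    then have "(\<lambda>i. if i < n then x i else w (i - n)) (n + m + 1) = r" by simp
    then show ?thesis using splice_in_XA[OF x w(1,2)]
      by (intro bexI[of _ "\<lambda>i. if i < n then x i else w (i - n)"]) (auto simp: agree_def)
  qed
  show "\<exists>z\<in>XA N A. z \<noteq> x \<and> agree n x z"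
    using ext[OF ij(2,5)] ext[OF ij(3,6)] ij(4) by metis
qed

end

section \<open>Periodic points and orbits\<close>

definition periodic :: "(nat \<Rightarrow> nat) \<Rightarrow> bool" where
  "periodic x \<longleftrightarrow> (\<exists>n>0. shiftn n x = x)"

definition period :: "(nat \<Rightarrow> nat) \<Rightarrow> nat" where
  "period x = (LEAST n. n > 0 \<and> shiftn n x = x)"

definition orbit :: "(nat \<Rightarrow> nat) \<Rightarrow> (nat \<Rightarrow> nat) set" where
  "orbit x = range (\<lambda>i. shiftn i x)"

text \<open>Points are compared up to initial segments, because the image of a periodic point under
  \<open>h\<close> need only be eventually periodic.\<close>

definition tail_equiv :: "(nat \<Rightarrow> nat) \<Rightarrow> (nat \<Rightarrow> nat) \<Rightarrow> bool" where
  "tail_equiv x z \<longleftrightarrow> (\<exists>m n. shiftn m x = shiftn n z)"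

lemma period_props:
  assumes "periodic x"
  shows "period x > 0" "shiftn (period x) x = x"
  using LeastI_ex[OF assms[unfolded periodic_def]] by (auto simp: period_def)

lemma period_dvd:
  assumes "periodic x"
  shows "shiftn n x = x \<longleftrightarrow> period x dvd n"
proof
  assume n: "shiftn n x = x"
  define r where "r = n mod period x"
  have "shiftn n x = shiftn (r + n div period x * period x) x"
    by (simp add: r_def)
  also have "\<dots> = shiftn r x"
    using shiftn_mult_periodic[OF period_props(2)[OF assms], of "n div period x"]
    by (metis shiftn_shiftn)
  finally have "shiftn r x = x" using n by simp
  moreover have "r < period x" using period_props(1)[OF assms] by (simp add: r_def)
  ultimately have "r = 0"
    using not_less_Least[of r "\<lambda>n. n > 0 \<and> shiftn n x = x"] by (auto simp: period_def)
  then show "period x dvd n" by (simp add: r_def dvd_eq_mod_eq_0)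
next
  assume "period x dvd n"
  then show "shiftn n x = x"
    using shiftn_mult_periodic[OF period_props(2)[OF assms]] by (metis dvdE mult.commute)
qed

lemma tail_equiv_sym: "tail_equiv x z \<Longrightarrow> tail_equiv z x"
  unfolding tail_equiv_def by metis

lemma tail_equiv_trans:
  assumes "tail_equiv x y" "tail_equiv y z"
  shows "tail_equiv x z"
proof -
  obtain a b c d where "shiftn a x = shiftn b y" "shiftn c y = shiftn d z"
    using assms unfolding tail_equiv_def by blast
  then have "shiftn (c + a) x = shiftn (b + d) z"
    by (metis shiftn_shiftn add.commute)
  then show ?thesis unfolding tail_equiv_def by blast
qed

lemma tail_equiv_shiftn: "tail_equiv (shiftn n x) x"
  unfolding tail_equiv_def by (metis shiftn_0)

text \<open>A periodic \<open>z\<close> is recovered from its \<open>n\<close>-th shift by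
  completing \<open>n\<close> to a multiple of the period.\<close>

lemma tail_equiv_periodic:
  assumes "periodic z" "tail_equiv x z"
  obtains i where "z = shiftn i x"
proof -
  obtain m n where mn: "shiftn m x = shiftn n z" using assms by (auto simp: tail_equiv_def)
  have p: "period z > 0" "shiftn (n * period z) z = z"
    using period_props[OF assms(1)] shiftn_mult_periodic by auto
  then have "n \<le> n * period z" by simp
  then have "shiftn (n * period z - n) (shiftn n z) = z" using p by simp
  then have "z = shiftn (n * period z - n + m) x" using mn by (metis shiftn_shiftn)
  then show ?thesis using that by blast
qed

lemma periodic_shiftn_iff_return:
  assumes "periodic x"
  shows "shiftn n (shiftn i x) = shiftn i x \<longleftrightarrow> shiftn n x = x"
proof
  assume n: "shiftn n (shiftn i x) = shiftn i x"
  obtain j where j: "x = shiftn j (shiftn i x)"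
    using tail_equiv_periodic[OF assms tail_equiv_shiftn] .
  then show "shiftn n x = x" using n by (metis add.commute shiftn_shiftn)
next
  assume "shiftn n x = x"
  then show "shiftn n (shiftn i x) = shiftn i x" by (metis add.commute shiftn_shiftn)
qed

lemma periodic_shiftn: "periodic x \<Longrightarrow> periodic (shiftn i x)"
  using periodic_shiftn_iff_return unfolding periodic_def by blast

lemma period_shiftn: "periodic x \<Longrightarrow> period (shiftn i x) = period x"
  using periodic_shiftn_iff_return by (simp add: period_def)

lemma orbit_self: "x \<in> orbit x"
  unfolding orbit_def by (metis rangeI shiftn_0)

lemma orbit_shiftn_subset: "orbit (shiftn i x) \<subseteq> orbit x"
  by (auto simp: orbit_def)

lemma orbit_eqI:
  assumes "periodic x" "periodic z" "tail_equiv x z"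
  shows "orbit x = orbit z"
  using tail_equiv_periodic[OF assms(2,3)] tail_equiv_periodic[OF assms(1) tail_equiv_sym[OF assms(3)]]
    orbit_shiftn_subset by (metis subset_antisym)

lemma orbit_member:
  assumes "periodic x" "z \<in> orbit x"
  shows "periodic z" "period z = period x" "orbit z = orbit x" "tail_equiv z x"
proof -
  obtain i where z: "z = shiftn i x" using assms(2) by (auto simp: orbit_def)
  show t: "tail_equiv z x" using z tail_equiv_shiftn by simp
  show p: "periodic z" using z periodic_shiftn assms(1) by simp
  show "period z = period x" using z period_shiftn assms(1) by simp
  show "orbit z = orbit x" using orbit_eqI[OF p assms(1) t] .
qed

lemma orbit_image_period:
  assumes "periodic x"
  shows "bij_betw (\<lambda>i. shiftn i x) {..<period x} (orbit x)"
proof -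
  let ?p = "period x"
  note p = period_props[OF assms]
  have "i = j" if ij: "i \<le> j" "j < ?p" "shiftn i x = shiftn j x" for i j
  proof -
    \<comment> \<open>Completing \<open>i\<close> to a full period turns the coincidence into a
      return time of \<open>x\<close> whose excess over the period is \<open>j - i\<close>.\<close>
    have "shiftn (?p - i) (shiftn i x) = shiftn (?p - i) (shiftn j x)" using ij by simp
    moreover have "shiftn (?p - i) (shiftn i x) = x" using ij(1,2) p by simp
    ultimately have "shiftn (?p + (j - i)) x = x" using ij(1,2) by simp
    then have "?p dvd ?p + (j - i)" using period_dvd[OF assms] by blast
    then have "?p dvd j - i" by simp
    then show ?thesis using ij by (auto dest: dvd_imp_le)
  qed
  then have "inj_on (\<lambda>i. shiftn i x) {..<?p}"
    by (intro inj_onI) (metis lessThan_iff nat_le_linear)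
  moreover have "shiftn i x \<in> (\<lambda>i. shiftn i x) ` {..<?p}" for i
  proof -
    have "shiftn i x = shiftn (i mod ?p) (shiftn (i div ?p * ?p) x)" by simp
    then have "shiftn i x = shiftn (i mod ?p) x"
      using shiftn_mult_periodic[OF p(2)] by simp
    then show ?thesis using p(1) by auto
  qed
  ultimately show ?thesis by (auto simp: bij_betw_def orbit_def)
qed

lemma finite_orbit: "periodic x \<Longrightarrow> finite (orbit x)"
  using orbit_image_period bij_betw_finite by blast

lemma card_orbit: "periodic x \<Longrightarrow> card (orbit x) = period x"
  using orbit_image_period bij_betw_same_card by fastforce

section \<open>Periodic orbits and their weights\<close>

definition periodic_points :: "nat \<Rightarrow> (nat \<Rightarrow> nat \<Rightarrow> nat) \<Rightarrow> (nat \<Rightarrow> nat) set" where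
  "periodic_points N A = {x \<in> XA N A. periodic x}"

definition orbits :: "nat \<Rightarrow> (nat \<Rightarrow> nat \<Rightarrow> nat) \<Rightarrow> (nat \<Rightarrow> nat) set set" where
  "orbits N A = orbit ` periodic_points N A"

text \<open>On a periodic orbit the sum over a full turn does not depend on the starting point, so
  any representative may be chosen; \<open>card Q\<close> is then its least period.\<close>

definition orbit_weight :: "((nat \<Rightarrow> nat) \<Rightarrow> int) \<Rightarrow> (nat \<Rightarrow> nat) set \<Rightarrow> int" where
  "orbit_weight g Q = birkhoff g (card Q) (SOME x. x \<in> Q)"

lemma orbits_memberD:
  assumes "Q \<in> orbits N A" "x \<in> Q"
  shows "x \<in> periodic_points N A" "orbit x = Q" "card Q = period x"
proof -
  obtain z where z: "z \<in> periodic_points N A" "Q = orbit z" using assms by (auto simp: orbits_def)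
  then have pz: "periodic z" "z \<in> XA N A" by (auto simp: periodic_points_def)
  note m = orbit_member[OF pz(1), of x]
  show "orbit x = Q" using m z assms by simp
  show "card Q = period x" using m z assms card_orbit pz by simp
  have "x \<in> XA N A" using assms(2) z(2) pz(2) shiftn_in_XA by (auto simp: orbit_def)
  then show "x \<in> periodic_points N A" using m assms z by (simp add: periodic_points_def)
qed

lemma orbit_weight_eq:
  assumes "Q \<in> orbits N A" "x \<in> Q"
  shows "orbit_weight g Q = birkhoff g (period x) x"
proof -
  have p: "periodic x" and Q: "orbit x = Q" "card Q = period x"
    using orbits_memberD[OF assms] by (auto simp: periodic_points_def)
  have "(SOME x. x \<in> Q) \<in> Q" using assms(2) by (metis someI)
  then obtain i where "(SOME x. x \<in> Q) = shiftn i x" using Q(1) by (auto simp: orbit_def)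
  then show ?thesis
    using Q birkhoff_shift_invariant[OF period_props(2)[OF p]] by (simp add: orbit_weight_def)
qed

section \<open>The zeta function as a sum over orbits\<close>

definition per_term :: "((nat \<Rightarrow> nat) \<Rightarrow> int) \<Rightarrow> complex \<Rightarrow> nat \<times> (nat \<Rightarrow> nat) \<Rightarrow> complex" where
  "per_term g s = (\<lambda>(n, x). (1 / of_nat n) * exp (- s * of_int (birkhoff g n x)))"

text \<open>The contribution of the \<open>j\<close>-fold traversal of \<open>Q\<close>: each of its
  \<open>card Q\<close> points carries the factor \<open>1 / (j * card Q)\<close>, which leaves
  \<open>1 / j\<close> in total.\<close>

definition orb_term :: "((nat \<Rightarrow> nat) set \<Rightarrow> int) \<Rightarrow> complex \<Rightarrow> (nat \<Rightarrow> nat) set \<times> nat \<Rightarrow> complex" where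
  "orb_term w s = (\<lambda>(Q, j). (1 / of_nat j) * exp (- s * of_int (int j * w Q)))"

text \<open>A point of \<open>Per N A n\<close> is determined by its first \<open>n\<close>
  symbols.\<close>

lemma Per_bound:
  assumes "n > 0"
  shows "finite (Per N A n)" "card (Per N A n) \<le> N ^ n"
proof -
  let ?r = "\<lambda>x. restrict x {..<n}"
  have inj: "inj_on ?r (Per N A n)"
  proof (rule inj_onI)
    fix x z assume x: "x \<in> Per N A n" and z: "z \<in> Per N A n" and eq: "?r x = ?r z"
    have rec: "w i = w (i mod n)" if "w \<in> Per N A n" for w i
    proof -
      have "shiftn (i div n * n) w = w" using that shiftn_mult_periodic by (simp add: Per_def)
      then have "w (i mod n) = shiftn (i div n * n) w (i mod n)" by simp
      then show ?thesis by (simp add: shiftn_def)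
    qed
    have "x i = z i" for i
      using rec[OF x] rec[OF z] fun_cong[OF eq, of "i mod n"] assms by (metis lessThan_iff mod_less_divisor restrict_apply')
    then show "x = z" by blast
  qed
  have sub: "?r ` Per N A n \<subseteq> PiE {..<n} (\<lambda>_. {1..N})" by (auto simp: Per_def XA_def PiE_def extensional_def)
  have fin: "finite (PiE {..<n} (\<lambda>_. {1..N}))" by (intro finite_PiE) auto
  show "finite (Per N A n)" using inj sub fin by (metis finite_imageD finite_subset)
  have "card (Per N A n) = card (?r ` Per N A n)" using inj by (simp add: card_image)
  also have "\<dots> \<le> N ^ n" using card_mono[OF fin sub] by (simp add: card_PiE)
  finally show "card (Per N A n) \<le> N ^ n" .
qed

lemma zeta_term_eq_sum: "zeta_term N A g s m = (\<Sum>x\<in>Per N A (Suc m). per_term g s (Suc m, x))"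
  by (simp add: zeta_term_def per_term_def sum_distrib_left Let_def)

lemma per_term_sum:
  assumes abs: "per_term g s abs_summable_on (Sigma {1..} (Per N A))"
  shows "summable (zeta_term N A g s)"
    and "suminf (zeta_term N A g s) = infsum (per_term g s) (Sigma {1..} (Per N A))"
proof -
  have "(per_term g s has_sum infsum (per_term g s) (Sigma {1..} (Per N A))) (Sigma {1..} (Per N A))"
    using abs abs_summable_summable by (metis has_sum_infsum)
  then have "((\<lambda>n. \<Sum>x\<in>Per N A n. per_term g s (n, x)) has_sum
      infsum (per_term g s) (Sigma {1..} (Per N A))) {1..}"
    by (rule has_sum_Sigma') (use Per_bound in \<open>auto intro!: has_sum_finite\<close>)
  \<comment> \<open>The index of \<open>zeta_term\<close> starts at 0 while return times start at 1,
    hence the reindexing by \<open>Suc\<close>.\<close>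
  then have "(zeta_term N A g s has_sum infsum (per_term g s) (Sigma {1..} (Per N A))) UNIV"
    by (subst (asm) has_sum_reindex_bij_betw[of Suc UNIV "{1..}", symmetric])
      (auto simp: bij_betw_def zeta_term_eq_sum[abs_def] image_iff Suc_le_eq gr0_conv_Suc)
  from has_sum_imp_sums[OF this] show "summable (zeta_term N A g s)"
    and "suminf (zeta_term N A g s) = infsum (per_term g s) (Sigma {1..} (Per N A))"
    by (auto simp: sums_iff)
qed

text \<open>A return time of \<open>x\<close> is a multiple of its least period, so it amounts to a
  repetition number of the orbit. Keeping the point in the index makes the correspondence one to
  one.\<close>

lemma per_orb_bij:
  "bij_betw (\<lambda>((Q, j), x). (j * card Q, x)) (Sigma (orbits N A \<times> {1..}) fst) (Sigma {1..} (Per N A))"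
proof (rule bij_betw_byWitness[where f' = "\<lambda>(n, x). ((orbit x, n div period x), x)"])
  show "\<forall>a\<in>Sigma (orbits N A \<times> {1..}) fst.
      (\<lambda>(n, x). ((orbit x, n div period x), x)) ((\<lambda>((Q, j), x). (j * card Q, x)) a) = a"
    using orbits_memberD period_props(1) by (fastforce simp: periodic_points_def)
  have P: "x \<in> periodic_points N A \<and> period x dvd n" if "n \<ge> 1" "x \<in> Per N A n" for n x
  proof -
    have "periodic x" using that by (auto simp: Per_def periodic_def intro!: exI[of _ n])
    then show ?thesis using that period_dvd by (auto simp: Per_def periodic_points_def)
  qed
  show "\<forall>a\<in>Sigma {1..} (Per N A).
      (\<lambda>((Q, j), x). (j * card Q, x)) ((\<lambda>(n, x). ((orbit x, n div period x), x)) a) = a"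
    using P card_orbit by (fastforce simp: periodic_points_def)
  have "j * card Q \<ge> 1 \<and> x \<in> Per N A (j * card Q)"
    if Q: "Q \<in> orbits N A" "j \<ge> 1" "x \<in> Q" for Q j x
  proof -
    note m = orbits_memberD[OF Q(1,3)]
    then have "periodic x" "x \<in> XA N A" by (auto simp: periodic_points_def)
    then show ?thesis
      using m(3) Q(2) period_props shiftn_mult_periodic by (simp add: Per_def Suc_le_eq)
  qed
  then show "(\<lambda>((Q, j), x). (j * card Q, x)) ` Sigma (orbits N A \<times> {1..}) fst \<subseteq> Sigma {1..} (Per N A)"
    by fastforce
  have "orbit x \<in> orbits N A \<and> n div period x \<ge> 1 \<and> x \<in> orbit x"
    if n: "n \<ge> 1" "x \<in> Per N A n" for n x
  proof -
    have *: "x \<in> periodic_points N A" "period x dvd n" using P n by auto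
    then have "n div period x > 0"
      using n(1) period_props(1) by (auto simp: periodic_points_def div_greater_zero_iff dvd_imp_le)
    then show ?thesis
      using * orbit_self by (auto simp: orbits_def)
  qed
  then show "(\<lambda>(n, x). ((orbit x, n div period x), x)) ` Sigma {1..} (Per N A) \<subseteq> Sigma (orbits N A \<times> {1..}) fst"
    by auto
qed

lemma orbit_props:
  assumes "Q \<in> orbits N A"
  shows "finite Q" "card Q > 0"
  using assms finite_orbit card_orbit period_props(1) by (auto simp: orbits_def periodic_points_def)

lemma per_term_orbit:
  assumes "Q \<in> orbits N A" "x \<in> Q"
  shows "per_term g s (j * card Q, x) = orb_term (orbit_weight g) s (Q, j) / of_nat (card Q)"
proof -
  have "birkhoff g (j * card Q) x = int j * orbit_weight g Q"
    using orbit_weight_eq[OF assms] orbits_memberD[OF assms] period_props(2)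
      birkhoff_mult_periodic[of "period x" x g j] by (simp add: periodic_points_def)
  then show ?thesis by (simp add: per_term_def orb_term_def field_simps)
qed

text \<open>The fibre over \<open>(Q, j)\<close> is the finite set \<open>Q\<close>, on which all
  terms are equal; summing over it removes the factor \<open>1 / card Q\<close>. Summability is an
  equivalence so that convergence can be carried from one shift to the other.\<close>

lemma per_term_orb_term:
  shows "per_term g s abs_summable_on (Sigma {1..} (Per N A)) \<longleftrightarrow>
      orb_term (orbit_weight g) s abs_summable_on (orbits N A \<times> {1..})"
    and "per_term g s abs_summable_on (Sigma {1..} (Per N A)) \<Longrightarrow>
      infsum (per_term g s) (Sigma {1..} (Per N A)) =
      infsum (orb_term (orbit_weight g) s) (orbits N A \<times> {1..})"
proof -
  let ?S = "Sigma (orbits N A \<times> {1::nat..}) fst"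
  let ?t = "\<lambda>((Q, j), x). per_term g s (j * card Q, x)"
  have t: "?t = (\<lambda>a. per_term g s ((\<lambda>((Q, j), x). (j * card Q, x)) a))" by auto
  have iff1: "per_term g s abs_summable_on (Sigma {1..} (Per N A)) \<longleftrightarrow> ?t abs_summable_on ?S"
    unfolding t using summable_on_reindex_bij_betw[OF per_orb_bij[of N A], of "\<lambda>x. norm (per_term g s x)"]
    by simp
  have sum1: "infsum (per_term g s) (Sigma {1..} (Per N A)) = infsum ?t ?S"
    unfolding t using infsum_reindex_bij_betw[OF per_orb_bij[of N A], of "per_term g s"] by simp
  have fin: "finite (fst a)" if "a \<in> orbits N A \<times> {1::nat..}" for a
    using that orbit_props(1) by auto
  have inner: "(\<Sum>x\<in>fst a. norm (?t (a, x))) = norm (orb_term (orbit_weight g) s a)"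
    "(\<Sum>x\<in>fst a. ?t (a, x)) = orb_term (orbit_weight g) s a"
    if a: "a \<in> orbits N A \<times> {1..}" for a
  proof -
    obtain Q j where [simp]: "a = (Q, j)" by (cases a)
    have Q: "Q \<in> orbits N A" using a by simp
    have "?t (a, x) = orb_term (orbit_weight g) s (Q, j) / of_nat (card Q)" if "x \<in> Q" for x
      using per_term_orbit[OF Q that] by simp
    then show "(\<Sum>x\<in>fst a. norm (?t (a, x))) = norm (orb_term (orbit_weight g) s a)"
      "(\<Sum>x\<in>fst a. ?t (a, x)) = orb_term (orbit_weight g) s a"
      using orbit_props(2)[OF Q] by (simp_all add: norm_divide card_gt_0_iff)
  qed
  have "?t abs_summable_on ?S \<longleftrightarrow> (\<lambda>a. infsum (\<lambda>x. norm (?t (a, x))) (fst a)) abs_summable_on (orbits N A \<times> {1..})"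
    unfolding Infinite_Sum.abs_summable_on_Sigma_iff using fin by auto
  also have "\<dots> \<longleftrightarrow> orb_term (orbit_weight g) s abs_summable_on (orbits N A \<times> {1..})"
    using inner(1) fin by (intro summable_on_cong) (simp del: split_paired_All)
  finally have iff2: "?t abs_summable_on ?S \<longleftrightarrow> orb_term (orbit_weight g) s abs_summable_on (orbits N A \<times> {1..})" .
  show "per_term g s abs_summable_on (Sigma {1..} (Per N A)) \<longleftrightarrow>
      orb_term (orbit_weight g) s abs_summable_on (orbits N A \<times> {1..})"
    using iff1 iff2 by simp
  assume "per_term g s abs_summable_on (Sigma {1..} (Per N A))"
  then have "?t summable_on ?S" using iff1 abs_summable_summable by blast
  then have "infsum ?t ?S = infsum (\<lambda>a. infsum (\<lambda>x. ?t (a, x)) (fst a)) (orbits N A \<times> {1..})"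
    by (subst infsum_Sigma'_banach) auto
  also have "\<dots> = infsum (orb_term (orbit_weight g) s) (orbits N A \<times> {1..})"
    using inner(2) fin by (intro infsum_cong) (simp del: split_paired_All)
  finally show "infsum (per_term g s) (Sigma {1..} (Per N A)) =
      infsum (orb_term (orbit_weight g) s) (orbits N A \<times> {1..})"
    using sum1 by simp
qed

text \<open>The orbit series of the two weights are rearrangements of each other. Convergence is
  assumed for \<open>f\<close> and passes to \<open>g\<close> along the bijection, which is how a
  cocycle weight obtains it.\<close>

lemma zeta_transfer:
  assumes bij: "bij_betw \<xi> (orbits N A) (orbits M B)"
    and w: "\<And>Q. Q \<in> orbits N A \<Longrightarrow> orbit_weight g Q = orbit_weight f (\<xi> Q)"
    and abs: "per_term f s abs_summable_on (Sigma {1..} (Per M B))"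
  shows "summable (zeta_term M B f s)" "summable (zeta_term N A g s)" "zeta M B f s = zeta N A g s"
proof -
  have bij2: "bij_betw (\<lambda>(Q, j). (\<xi> Q, j)) (orbits N A \<times> {1::nat..}) (orbits M B \<times> {1..})"
  proof -
    have "(\<lambda>(Q, j). (\<xi> Q, j)) ` (orbits N A \<times> {1::nat..}) = \<xi> ` orbits N A \<times> {1..}" by force
    then show ?thesis using bij by (auto simp: bij_betw_def inj_on_def)
  qed
  have t: "orb_term (orbit_weight g) s a = orb_term (orbit_weight f) s ((\<lambda>(Q, j). (\<xi> Q, j)) a)"
    if "a \<in> orbits N A \<times> {1..}" for a
    using that w by (auto simp: orb_term_def)
  have absf: "orb_term (orbit_weight f) s abs_summable_on (orbits M B \<times> {1..})"
    using abs per_term_orb_term(1) by blast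
  have "(\<lambda>a. orb_term (orbit_weight f) s ((\<lambda>(Q, j). (\<xi> Q, j)) a)) abs_summable_on (orbits N A \<times> {1..})"
    using absf summable_on_reindex_bij_betw[OF bij2, of "\<lambda>x. norm (orb_term (orbit_weight f) s x)"] by simp
  then have "orb_term (orbit_weight g) s abs_summable_on (orbits N A \<times> {1..})"
    using t by (subst summable_on_cong) auto
  then have absg: "per_term g s abs_summable_on (Sigma {1..} (Per N A))"
    using per_term_orb_term(1) by blast
  have "infsum (orb_term (orbit_weight g) s) (orbits N A \<times> {1..}) =
      infsum (\<lambda>a. orb_term (orbit_weight f) s ((\<lambda>(Q, j). (\<xi> Q, j)) a)) (orbits N A \<times> {1..})"
    using t by (rule infsum_cong)
  also have "\<dots> = infsum (orb_term (orbit_weight f) s) (orbits M B \<times> {1..})"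
    by (rule infsum_reindex_bij_betw[OF bij2])
  finally show "zeta M B f s = zeta N A g s"
    using per_term_sum(2)[OF abs] per_term_sum(2)[OF absg] per_term_orb_term(2)[OF abs]
      per_term_orb_term(2)[OF absg] by (simp add: zeta_def)
  show "summable (zeta_term M B f s)" "summable (zeta_term N A g s)"
    using per_term_sum(1) abs absg by auto
qed

text \<open>At most \<open>N ^ n\<close> points return after \<open>n\<close> steps and each has
  weight at least \<open>n / m\<close>, so a geometric series dominates. \<open>Suc N\<close> keeps
  the logarithm nonnegative for every \<open>N\<close>.\<close>

lemma per_term_abs_summable:
  assumes lower: "\<And>n x. n > 0 \<Longrightarrow> x \<in> Per N A n \<Longrightarrow> int n \<le> int m * birkhoff g n x"
    and m: "m > 0" and s: "Re s > real m * ln (real (Suc N))"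
  shows "per_term g s abs_summable_on (Sigma {1..} (Per N A))"
proof -
  \<comment> \<open>A point of weight at least \<open>n / m\<close> contributes at most
    \<open>q ^ n\<close>; the bound on \<open>Re s\<close> is the condition
    \<open>real (Suc N) * q < 1\<close>.\<close>
  define q where "q = exp (- Re s / real m)"
  have q: "0 < q" "real (Suc N) * q < 1"
  proof -
    have "ln (real (Suc N)) < Re s / real m" using s m by (simp add: field_simps)
    then have "exp (ln (real (Suc N))) < exp (Re s / real m)" by (simp only: exp_less_mono)
    then have "real (Suc N) < exp (Re s / real m)" by simp
    then show "real (Suc N) * q < 1" by (simp add: q_def exp_minus field_simps)
  qed (simp add: q_def)
  have "Re s > 0" using s m by (smt (verit) ln_ge_zero mult_nonneg_nonneg of_nat_0_le_iff of_nat_Suc)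
  have term_bound: "norm (per_term g s (n, x)) \<le> q ^ n" if n: "n \<ge> 1" "x \<in> Per N A n" for n x
  proof -
    have "real_of_int (int n) \<le> real_of_int (int m * birkhoff g n x)"
      using lower[of n x] n by (simp only: of_int_le_iff)
    then have "real n / real m \<le> real_of_int (birkhoff g n x)"
      using m by (simp add: field_simps)
    then have "Re s * (real n / real m) \<le> Re s * real_of_int (birkhoff g n x)"
      using \<open>Re s > 0\<close> by (intro mult_left_mono) auto
    then have "exp (- Re s * of_int (birkhoff g n x)) \<le> exp (of_nat n * (- Re s / real m))"
      by (simp add: field_simps)
    also have "\<dots> = q ^ n" unfolding q_def by (rule exp_of_nat_mult)
    finally have "exp (- Re s * of_int (birkhoff g n x)) \<le> q ^ n" .
    moreover have "norm (per_term g s (n, x)) \<le> exp (- Re s * of_int (birkhoff g n x))"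
      using n by (simp add: per_term_def norm_mult norm_divide divide_le_eq)
    ultimately show ?thesis by simp
  qed
  have fin: "finite (Per N A n)" if "n \<in> {1..}" for n using that Per_bound(1) by auto
  have sum_bound: "(\<Sum>x\<in>Per N A n. norm (per_term g s (n, x))) \<le> (real (Suc N) * q) ^ n"
    if n: "n \<ge> 1" for n
  proof -
    have "(\<Sum>x\<in>Per N A n. norm (per_term g s (n, x))) \<le> real (card (Per N A n)) * q ^ n"
      using sum_bounded_above[of "Per N A n" "\<lambda>x. norm (per_term g s (n, x))" "q ^ n"] term_bound[OF n]
      by simp
    also have "\<dots> \<le> real (Suc N) ^ n * q ^ n"
    proof (intro mult_right_mono)
      have "card (Per N A n) \<le> Suc N ^ n"
        using order_trans[OF Per_bound(2) power_mono[of N "Suc N" n]] n by simp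
      then show "real (card (Per N A n)) \<le> real (Suc N) ^ n" by (metis of_nat_le_iff of_nat_power)
    qed (use q in simp)
    finally show ?thesis by (simp add: power_mult_distrib)
  qed
  have "summable (\<lambda>n. (real (Suc N) * q) ^ n)" using q by (intro summable_geometric) simp
  then have "(\<lambda>n. (real (Suc N) * q) ^ n) summable_on UNIV"
    using q by (intro summable_nonneg_imp_summable_on) auto
  then have "(\<lambda>n. (real (Suc N) * q) ^ n) summable_on {1..}"
    using summable_on_subset_banach by blast
  then have "(\<lambda>n. \<Sum>x\<in>Per N A n. norm (per_term g s (n, x))) summable_on {1..}"
    by (rule summable_on_comparison_test) (use sum_bound in \<open>auto intro: sum_nonneg\<close>)
  moreover have "norm (\<Sum>\<^sub>\<infinity>x\<in>Per N A n. norm (per_term g s (n, x))) =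
      (\<Sum>x\<in>Per N A n. norm (per_term g s (n, x)))" if "n \<in> {1..}" for n
    using fin[OF that] by (simp add: sum_nonneg)
  ultimately have "(\<lambda>n. \<Sum>\<^sub>\<infinity>x\<in>Per N A n. norm (per_term g s (n, x))) abs_summable_on {1..}"
    by (subst summable_on_cong) auto
  then show ?thesis
    unfolding Infinite_Sum.abs_summable_on_Sigma_iff using fin by auto
qed

section \<open>Orbit maps and their cocycles\<close>

text \<open>A Birkhoff sum kept in the natural numbers, because it serves as a number of
  shifts.\<close>

definition nat_sum :: "((nat \<Rightarrow> nat) \<Rightarrow> nat) \<Rightarrow> nat \<Rightarrow> (nat \<Rightarrow> nat) \<Rightarrow> nat" where
  "nat_sum l n x = (\<Sum>i<n. l (shiftn i x))"

lemma nat_sum_0 [simp]: "nat_sum l 0 x = 0"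
  by (simp add: nat_sum_def)

lemma nat_sum_Suc: "nat_sum l (Suc n) x = nat_sum l n x + l (shiftn n x)"
  by (simp add: nat_sum_def)

lemma lc_nat_sum:
  assumes "lc (XA N A) l"
  shows "lc (XA N A) (nat_sum l n)"
  unfolding nat_sum_def[abs_def] by (intro lc_sum lc_comp[OF assms] lc_to_shiftn)

lemma birkhoff_diff_nat_sum:
  "birkhoff (\<lambda>x. int (l x) - int (k x)) n x = int (nat_sum l n x) - int (nat_sum k n x)"
  by (simp add: birkhoff_def nat_sum_def sum_subtractf)

text \<open>The formula of \<open>Psi\<close> with explicit exponents in place of those selected by
  its choice operator.\<close>

definition cocycle :: "((nat \<Rightarrow> nat) \<Rightarrow> (nat \<Rightarrow> nat)) \<Rightarrow> ((nat \<Rightarrow> nat) \<Rightarrow> nat) \<Rightarrow> ((nat \<Rightarrow> nat) \<Rightarrow> nat)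
    \<Rightarrow> ((nat \<Rightarrow> nat) \<Rightarrow> int) \<Rightarrow> (nat \<Rightarrow> nat) \<Rightarrow> int" where
  "cocycle h k l \<phi> x = birkhoff \<phi> (l x) (h x) - birkhoff \<phi> (k x) (h (shift x))"

text \<open>One half of a continuous orbit equivalence, instantiated once for \<open>h\<close> and
  once for its inverse.\<close>

locale orbit_map =
  fixes N :: nat and A :: "nat \<Rightarrow> nat \<Rightarrow> nat" and M :: nat and B :: "nat \<Rightarrow> nat \<Rightarrow> nat"
    and h :: "(nat \<Rightarrow> nat) \<Rightarrow> (nat \<Rightarrow> nat)" and k l :: "(nat \<Rightarrow> nat) \<Rightarrow> nat"
  assumes map_lc: "lc_to (XA N A) (XA M B) h"
    and k_lc: "lc (XA N A) k" and l_lc: "lc (XA N A) l"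
    and orbit_eq: "x \<in> XA N A \<Longrightarrow> shiftn (k x) (h (shift x)) = shiftn (l x) (h x)"
begin

lemma map_in: "x \<in> XA N A \<Longrightarrow> h x \<in> XA M B"
  using map_lc by (auto simp: lc_to_def)

lemma orbit_eq_iterate:
  assumes x: "x \<in> XA N A"
  shows "shiftn (nat_sum k n x) (h (shiftn n x)) = shiftn (nat_sum l n x) (h x)"
proof (induction n)
  case (Suc n)
  let ?z = "shiftn n x"
  have "shiftn (nat_sum k (Suc n) x) (h (shiftn (Suc n) x))
      = shiftn (nat_sum k n x) (shiftn (k ?z) (h (shift ?z)))"
    by (simp add: nat_sum_Suc shiftn_Suc)
  also have "\<dots> = shiftn (l ?z) (shiftn (nat_sum k n x) (h ?z))"
    using orbit_eq[OF shiftn_in_XA[OF x]] by (simp add: add.commute)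
  also have "\<dots> = shiftn (nat_sum l (Suc n) x) (h x)"
    unfolding Suc by (simp add: nat_sum_Suc add.commute)
  finally show ?case .
qed simp

text \<open>After \<open>nat_sum l n x\<close> and \<open>nat_sum k n x\<close> steps the points
  \<open>h x\<close> and \<open>h (shiftn n x)\<close> meet, and extending meeting orbits by equally
  many steps leaves the difference of their sums unchanged. Hence the single-step terms
  telescope.\<close>

lemma birkhoff_cocycle:
  assumes x: "x \<in> XA N A"
  shows "birkhoff (cocycle h k l \<phi>) n x =
    birkhoff \<phi> (nat_sum l n x) (h x) - birkhoff \<phi> (nat_sum k n x) (h (shiftn n x))"
proof (induction n)
  case (Suc n)
  let ?z = "shiftn n x" and ?L = "nat_sum l n x" and ?K = "nat_sum k n x"
  have z: "shiftn (l ?z) (h ?z) = shiftn (k ?z) (h (shift ?z))"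
    using orbit_eq[OF shiftn_in_XA[OF x]] by simp
  \<comment> \<open>The orbit of \<open>h x\<close> is continued from the point where it meets that
    of \<open>h ?z\<close>; the added stretch is then measured from \<open>h ?z\<close>
    itself.\<close>
  have "birkhoff \<phi> (?L + l ?z) (h x) = birkhoff \<phi> ?L (h x) + birkhoff \<phi> (l ?z) (shiftn ?K (h ?z))"
    unfolding birkhoff_add orbit_eq_iterate[OF x] ..
  also have "\<dots> = birkhoff \<phi> ?L (h x) + birkhoff \<phi> (?K + l ?z) (h ?z) - birkhoff \<phi> ?K (h ?z)"
    unfolding birkhoff_add by simp
  also have "birkhoff \<phi> (?K + l ?z) (h ?z) = birkhoff \<phi> (l ?z) (h ?z) + birkhoff \<phi> ?K (shiftn (l ?z) (h ?z))"
    unfolding add.commute[of ?K] birkhoff_add ..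
  finally have 1: "birkhoff \<phi> (?L + l ?z) (h x) = birkhoff \<phi> ?L (h x) + birkhoff \<phi> (l ?z) (h ?z)
      + birkhoff \<phi> ?K (shiftn (k ?z) (h (shift ?z))) - birkhoff \<phi> ?K (h ?z)"
    unfolding z by simp
  have 2: "birkhoff \<phi> (?K + k ?z) (h (shift ?z)) =
      birkhoff \<phi> (k ?z) (h (shift ?z)) + birkhoff \<phi> ?K (shiftn (k ?z) (h (shift ?z)))"
    unfolding add.commute[of ?K] birkhoff_add ..
  show ?case
    unfolding birkhoff_Suc[of "cocycle h k l \<phi>"] Suc nat_sum_Suc shiftn_Suc[of n x] 1 2
    by (simp add: cocycle_def)
qed simp

lemma tail_equiv_map_shiftn:
  assumes "x \<in> XA N A"
  shows "tail_equiv (h (shiftn n x)) (h x)"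
  using orbit_eq_iterate[OF assms] unfolding tail_equiv_def by blast

lemma tail_equiv_map:
  assumes "x \<in> XA N A" "z \<in> XA N A" "tail_equiv x z"
  shows "tail_equiv (h x) (h z)"
proof -
  obtain m n where "shiftn m x = shiftn n z" using assms(3) by (auto simp: tail_equiv_def)
  then show ?thesis
    using tail_equiv_map_shiftn[OF assms(1), of m] tail_equiv_map_shiftn[OF assms(2), of n]
      tail_equiv_trans tail_equiv_sym by metis
qed

text \<open>Since \<open>x\<close> returns after \<open>p\<close> steps, \<open>h x\<close> reaches
  the same point after \<open>K\<close> and after \<open>K + W\<close> steps and so enters a cycle.
  Here \<open>W\<close> is a return time of \<open>y\<close>, not necessarily the least one.\<close>

lemma periodic_image:
  assumes x: "x \<in> XA N A" "shiftn p x = x"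
    and pos: "birkhoff (\<lambda>x. int (l x) - int (k x)) p x > 0"
  obtains y W where "y \<in> XA M B" "W > 0" "shiftn W y = y" "tail_equiv y (h x)"
    "birkhoff (\<lambda>x. int (l x) - int (k x)) p x = int W"
    "\<And>\<phi>. birkhoff (cocycle h k l \<phi>) p x = birkhoff \<phi> W y"
proof -
  define K where "K = nat_sum k p x"
  define W where "W = nat_sum l p x - K"
  have less: "K < nat_sum l p x"
    using pos unfolding birkhoff_diff_nat_sum K_def by simp
  then have L: "nat_sum l p x = K + W" by (simp add: W_def)
  let ?y = "shiftn K (h x)"
  show ?thesis
  proof (rule that[of ?y W])
    show "?y \<in> XA M B" using map_in x(1) shiftn_in_XA by blast
    show "W > 0" using less by (simp add: W_def)
    have "shiftn W ?y = shiftn (nat_sum l p x) (h x)" by (simp add: L add.commute)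
    also have "\<dots> = ?y" using orbit_eq_iterate[OF x(1), of p] x(2) K_def by simp
    finally show "shiftn W ?y = ?y" .
    show "tail_equiv ?y (h x)" by (rule tail_equiv_shiftn)
    show "birkhoff (\<lambda>x. int (l x) - int (k x)) p x = int W"
      unfolding birkhoff_diff_nat_sum L using K_def by simp
    show "birkhoff (cocycle h k l \<phi>) p x = birkhoff \<phi> W ?y" for \<phi>
      unfolding birkhoff_cocycle[OF x(1)] L x(2) birkhoff_add using K_def by simp
  qed
qed

end

text \<open>The positivity assumptions say that \<open>h\<close> and its inverse preserve the direction of time along
  periodic orbits.\<close>

locale orbit_equivalence =
  fwd: orbit_map N A M B h k l + bwd: orbit_map M B N A h' k' l'
  for N A M B h k l h' k' l' +
  assumes left_inv: "x \<in> XA N A \<Longrightarrow> h' (h x) = x" and right_inv: "y \<in> XA M B \<Longrightarrow> h (h' y) = y"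
    and perfect_dom: "perfect_seqs (XA N A)" and perfect_cod: "perfect_seqs (XA M B)"
    and fwd_pos: "\<lbrakk>x \<in> XA N A; p > 0; shiftn p x = x\<rbrakk> \<Longrightarrow>
      birkhoff (\<lambda>x. int (l x) - int (k x)) p x > 0"
    and bwd_pos: "\<lbrakk>y \<in> XA M B; p > 0; shiftn p y = y\<rbrakk> \<Longrightarrow>
      birkhoff (\<lambda>y. int (l' y) - int (k' y)) p y > 0"
begin

text \<open>Symmetry carries results over to the inverse map; surjectivity on orbits and the zeta
  identity for the inverse rest on it.\<close>

lemma orbit_equivalence_swap: "orbit_equivalence M B N A h' k' l' h k l"
  by unfold_locales (use left_inv right_inv perfect_dom perfect_cod fwd_pos bwd_pos in auto)

text \<open>The chain rule for \<open>h' (h x) = x\<close>: one step of the shift, carried forward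
  and back, has total exponent 1. Uniqueness of exponents turns the equality of shifts into this
  identity.\<close>

lemma cocycle_inverse:
  assumes x: "x \<in> XA N A"
  shows "cocycle h k l (\<lambda>y. int (l' y) - int (k' y)) x = 1"
proof -
  let ?X = "XA N A"
  have hs: "lc_to ?X (XA M B) (\<lambda>x. h (shift x))"
    by (rule lc_to_comp[OF lc_to_shift fwd.map_lc])
  \<comment> \<open>\<open>p\<close> and \<open>q\<close> collect the terms of either sign, so that
    both are natural; the 1 in \<open>q\<close> comes from starting at \<open>shift z\<close> rather
    than at \<open>z\<close>.\<close>
  define p where "p = (\<lambda>x. nat_sum k' (k x) (h (shift x)) + nat_sum l' (l x) (h x))"
  define q where "q = (\<lambda>x. nat_sum k' (l x) (h x) + nat_sum l' (k x) (h (shift x)) + 1)"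
  have lcp: "lc ?X p" unfolding p_def
    by (intro lc_map2[where F = "(+)"] lc_apply[OF fwd.k_lc, of "\<lambda>c x. nat_sum k' c (h (shift x))"]
        lc_apply[OF fwd.l_lc, of "\<lambda>c x. nat_sum l' c (h x)"] lc_comp[OF lc_nat_sum hs]
        lc_comp[OF lc_nat_sum fwd.map_lc] bwd.k_lc bwd.l_lc)
  have lcq: "lc ?X q" unfolding q_def
    by (intro lc_map2[where F = "(+)"] lc_const lc_apply[OF fwd.l_lc, of "\<lambda>c x. nat_sum k' c (h x)"]
        lc_apply[OF fwd.k_lc, of "\<lambda>c x. nat_sum l' c (h (shift x))"] lc_comp[OF lc_nat_sum hs]
        lc_comp[OF lc_nat_sum fwd.map_lc] bwd.k_lc bwd.l_lc)
  have eq: "shiftn (p z) z = shiftn (q z) z" if z: "z \<in> ?X" for z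
  proof -
    let ?a = "h z" and ?b = "h (shift z)"
    have ab: "?a \<in> XA M B" "?b \<in> XA M B" using z shift_in_XA fwd.map_in by auto
    \<comment> \<open>The orbits of \<open>?a\<close> and \<open>?b\<close> meet at
      \<open>shiftn (l z) ?a\<close>; its image under \<open>h'\<close> is compared with both
      \<open>z\<close> and \<open>shift z\<close>.\<close>
    let ?w = "h' (shiftn (l z) ?a)"
    have a: "shiftn (nat_sum k' (l z) ?a) ?w = shiftn (nat_sum l' (l z) ?a) z"
      using bwd.orbit_eq_iterate[OF ab(1), of "l z"] left_inv[OF z] by simp
    have b: "shiftn (nat_sum k' (k z) ?b) ?w = shiftn (nat_sum l' (k z) ?b) (shift z)"
      using bwd.orbit_eq_iterate[OF ab(2), of "k z"] left_inv[OF shift_in_XA[OF z]]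
        fwd.orbit_eq[OF z] by simp
    have "shiftn (p z) z = shiftn (nat_sum k' (k z) ?b) (shiftn (nat_sum l' (l z) ?a) z)"
      by (simp add: p_def)
    also have "\<dots> = shiftn (nat_sum k' (l z) ?a) (shiftn (nat_sum k' (k z) ?b) ?w)"
      unfolding a[symmetric] by (simp add: add.commute)
    also have "\<dots> = shiftn (q z) z"
      unfolding b by (simp add: q_def shift_eq_shiftn)
    finally show ?thesis .
  qed
  have "p x = q x" by (rule exponents_unique[OF perfect_dom lcp lcq eq x])
  then show ?thesis
    by (simp add: cocycle_def birkhoff_diff_nat_sum p_def q_def)
qed

text \<open>If the image orbit had period \<open>q < W\<close>, running around it \<open>W / q\<close> times would correspond under the
  inverse cocycle to a proper multiple of the period of \<open>x\<close>, contradicting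
  \<open>cocycle_inverse\<close>.\<close>

lemma periodic_point_image:
  assumes "x \<in> periodic_points N A"
  obtains y where "y \<in> periodic_points M B" "tail_equiv y (h x)"
    "\<And>\<phi>. birkhoff (cocycle h k l \<phi>) (period x) x = birkhoff \<phi> (period y) y"
proof -
  have x: "x \<in> XA N A" and px: "periodic x" using assms by (auto simp: periodic_points_def)
  note p = period_props[OF px]
  obtain y W where y: "y \<in> XA M B" "W > 0" "shiftn W y = y" "tail_equiv y (h x)"
    "birkhoff (\<lambda>x. int (l x) - int (k x)) (period x) x = int W"
    and \<phi>: "\<And>\<phi>. birkhoff (cocycle h k l \<phi>) (period x) x = birkhoff \<phi> W y"
    by (rule fwd.periodic_image[OF x p(2) fwd_pos[OF x p]]) (rule that)
  have py: "periodic y" using y by (auto simp: periodic_def)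
  note q = period_props[OF py]
  obtain x' V where x': "x' \<in> XA N A" "V > 0" "shiftn V x' = x'" "tail_equiv x' (h' y)"
    and V: "birkhoff (\<lambda>y. int (l' y) - int (k' y)) (period y) y = int V"
    and "\<And>\<phi>. birkhoff (cocycle h' k' l' \<phi>) (period y) y = birkhoff \<phi> V x'"
    by (rule bwd.periodic_image[OF y(1) q(2) bwd_pos[OF y(1) q]]) (rule that)
  \<comment> \<open>Mapping back leads into the cycle of \<open>x\<close>, so the return time
    \<open>V\<close> is a positive multiple of its period.\<close>
  have "tail_equiv (h' y) (h' (h x))" by (rule bwd.tail_equiv_map[OF y(1) fwd.map_in[OF x] y(4)])
  then have "tail_equiv x x'" using x'(4) left_inv[OF x] tail_equiv_trans tail_equiv_sym by metis
  moreover have "periodic x'" using x' by (auto simp: periodic_def)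
  ultimately have "period x' = period x"
    using tail_equiv_periodic period_shiftn[OF px] by metis
  then have "period x dvd V" using period_dvd[OF \<open>periodic x'\<close>] x'(3) by simp
  then have "period x \<le> V" using x'(2) dvd_imp_le by blast
  obtain r where r: "W = r * period y"
    using period_dvd[OF py] y(3) by (metis dvdE mult.commute)
  have "int (period x) = birkhoff (cocycle h k l (\<lambda>y. int (l' y) - int (k' y))) (period x) x"
    using birkhoff_cong[OF cocycle_inverse x] by simp
  also have "\<dots> = int r * int V"
    unfolding \<phi> r birkhoff_mult_periodic[OF q(2)] V ..
  finally have rV: "period x = r * V" by (metis of_nat_eq_iff of_nat_mult)
  have "r = 1"
  proof -
    have "r * V \<le> 1 * V" using rV \<open>period x \<le> V\<close> by simp
    then have "r \<le> 1" using x'(2) mult_le_cancel2 by blast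
    moreover have "r > 0" using r y(2) by (cases r) auto
    ultimately show ?thesis by simp
  qed
  then have "W = period y" using r by simp
  then show ?thesis using that[of y] y py \<phi> by (auto simp: periodic_points_def)
qed

text \<open>Tail equivalence singles out the cycle into which the images of \<open>Q\<close> fall,
  with no choice of a representative.\<close>

definition orbit_image :: "(nat \<Rightarrow> nat) set \<Rightarrow> (nat \<Rightarrow> nat) set" where
  "orbit_image Q = {y \<in> periodic_points M B. \<exists>x\<in>Q. tail_equiv y (h x)}"

lemma orbit_image_eq:
  assumes x: "x \<in> periodic_points N A" and y: "y \<in> periodic_points M B" and t: "tail_equiv y (h x)"
  shows "orbit_image (orbit x) = orbit y"
proof -
  have px: "periodic x" "x \<in> XA N A" and py: "periodic y" "y \<in> XA M B"
    using x y by (auto simp: periodic_points_def)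
  have "z \<in> orbit y" if z: "z \<in> periodic_points M B" "x' \<in> orbit x" "tail_equiv z (h x')" for z x'
  proof -
    have "tail_equiv (h x') (h x)" using z(2) fwd.tail_equiv_map_shiftn px by (auto simp: orbit_def)
    then have "tail_equiv y z" using z(3) t tail_equiv_trans tail_equiv_sym by metis
    then show ?thesis using tail_equiv_periodic[of z y] z(1) by (auto simp: periodic_points_def orbit_def)
  qed
  moreover have "z \<in> orbit_image (orbit x)" if z: "z \<in> orbit y" for z
  proof -
    have "z \<in> XA M B" using z shiftn_in_XA[OF py(2)] by (auto simp: orbit_def)
    moreover have "tail_equiv z (h x)" using tail_equiv_trans[OF orbit_member(4)[OF py(1) z] t] .
    ultimately show ?thesis
      using orbit_member(1)[OF py(1) z] orbit_self[of x] by (auto simp: orbit_image_def periodic_points_def)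
  qed
  ultimately show ?thesis by (auto simp: orbit_image_def)
qed

text \<open>Both maps respect tail equivalence, so images with a common cycle come from one orbit; a
  preimage of an orbit is found by the same construction applied to \<open>h'\<close>.\<close>

lemma orbit_image_bij: "bij_betw orbit_image (orbits N A) (orbits M B)"
proof -
  have img: "\<exists>y\<in>periodic_points M B. tail_equiv y (h x) \<and> orbit_image (orbit x) = orbit y"
    if x: "x \<in> periodic_points N A" for x
    using periodic_point_image[OF x] orbit_image_eq[OF x] by metis
  have "inj_on orbit_image (orbits N A)"
  proof (rule inj_onI)
    fix Q R assume "Q \<in> orbits N A" "R \<in> orbits N A" and eq: "orbit_image Q = orbit_image R"
    then obtain x z where x: "x \<in> periodic_points N A" "Q = orbit x"
      and z: "z \<in> periodic_points N A" "R = orbit z" by (auto simp: orbits_def)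
    obtain y where y: "y \<in> periodic_points M B" "tail_equiv y (h x)" "orbit_image Q = orbit y"
      using img x by blast
    obtain u where u: "u \<in> periodic_points M B" "tail_equiv u (h z)" "orbit_image R = orbit u"
      using img z by blast
    have "u \<in> orbit y" using eq y(3) u(3) orbit_self by metis
    then have "tail_equiv u y" using tail_equiv_shiftn by (auto simp: orbit_def)
    then have "tail_equiv (h x) (h z)" using y(2) u(2) tail_equiv_trans tail_equiv_sym by metis
    then have "tail_equiv (h' (h x)) (h' (h z))"
      using bwd.tail_equiv_map fwd.map_in x(1) z(1) by (simp add: periodic_points_def)
    then show "Q = R"
      using x z left_inv orbit_eqI by (simp add: periodic_points_def)
  qed
  moreover have "orbit_image ` orbits N A = orbits M B"
  proof
    show "orbit_image ` orbits N A \<subseteq> orbits M B" using img by (auto simp: orbits_def)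
    show "orbits M B \<subseteq> orbit_image ` orbits N A"
    proof
      fix R assume "R \<in> orbits M B"
      then obtain y where y: "y \<in> periodic_points M B" "R = orbit y" by (auto simp: orbits_def)
      then have yB: "y \<in> XA M B" by (simp add: periodic_points_def)
      obtain x where x: "x \<in> periodic_points N A" "tail_equiv x (h' y)"
        using orbit_equivalence.periodic_point_image[OF orbit_equivalence_swap y(1)] by metis
      have "tail_equiv (h x) (h (h' y))"
        using fwd.tail_equiv_map[OF _ bwd.map_in[OF yB] x(2)] x(1) by (simp add: periodic_points_def)
      then have "tail_equiv y (h x)" using right_inv[OF yB] tail_equiv_sym by simp
      then have "orbit_image (orbit x) = R" using orbit_image_eq x(1) y by simp
      then show "R \<in> orbit_image ` orbits N A" using x(1) by (auto simp: orbits_def)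
    qed
  qed
  ultimately show ?thesis by (simp add: bij_betw_def)
qed

lemma orbit_weight_image:
  assumes "Q \<in> orbits N A"
  shows "orbit_weight (cocycle h k l \<phi>) Q = orbit_weight \<phi> (orbit_image Q)"
proof -
  obtain x where x: "x \<in> periodic_points N A" "Q = orbit x" using assms by (auto simp: orbits_def)
  obtain y where y: "y \<in> periodic_points M B" "tail_equiv y (h x)"
    "birkhoff (cocycle h k l \<phi>) (period x) x = birkhoff \<phi> (period y) y"
    using periodic_point_image[OF x(1)] by metis
  have "orbit y \<in> orbits M B" using y(1) by (auto simp: orbits_def)
  then show ?thesis
    using orbit_weight_eq[OF assms, of x] orbit_weight_eq[of "orbit y" M B y] orbit_self
      orbit_image_eq[OF x(1) y(1,2)] x(2) y(3) by simp
qed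

lemmas zeta_cocycle = zeta_transfer[OF orbit_image_bij orbit_weight_image]

end

section \<open>Order units\<close>

lemma birkhoff_coboundary:
  "birkhoff (\<lambda>x. u x - u (shift x)) n x = u x - u (shiftn n x)"
  by (induction n) (simp_all add: birkhoff_Suc shiftn_Suc)

text \<open>Compare \<open>g\<close> with the constant 1: some multiple of \<open>g\<close> is at
  least 1 up to a coboundary, and coboundaries sum to zero around periodic orbits.\<close>

lemma order_unit_lower_bound:
  assumes "order_unit N A g"
  obtains m :: nat where "m > 0"
    "\<And>n x. x \<in> XA N A \<Longrightarrow> shiftn n x = x \<Longrightarrow> int n \<le> int m * birkhoff g n x"
proof -
  have "Cint N A (\<lambda>_. 1)" by (simp add: Cint_def)
  then obtain m :: nat where "in_Hplus N A (\<lambda>x. int m * g x - 1)"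
    using assms unfolding order_unit_def by blast
  then obtain p u where p: "\<And>x. x \<in> XA N A \<Longrightarrow> p x \<ge> 0"
    and u: "\<And>x. x \<in> XA N A \<Longrightarrow> int m * g x - 1 - p x = u x - u (shift x)"
    unfolding in_Hplus_def cohom_def by blast
  have bound: "int n \<le> int m * birkhoff g n x" if x: "x \<in> XA N A" "shiftn n x = x" for n x
  proof -
    have "birkhoff (\<lambda>x. int m * g x - 1 - p x) n x = birkhoff (\<lambda>x. u x - u (shift x)) n x"
      using birkhoff_cong[OF u x(1)] .
    also have "\<dots> = 0" using x(2) by (simp add: birkhoff_coboundary)
    finally have "int m * birkhoff g n x - int n - birkhoff p n x = 0"
      by (simp add: birkhoff_def sum_subtractf sum_distrib_left)
    moreover have "birkhoff p n x \<ge> 0"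
      unfolding birkhoff_def using p shiftn_in_XA[OF x(1)] by (intro sum_nonneg) auto
    ultimately show ?thesis by simp
  qed
  show ?thesis
  \<comment> \<open>The definition of an order unit allows the multiple 0. The bound then rules out
    positive return times, and 1 serves as \<open>m\<close>.\<close>
  proof (cases "m = 0")
    case True
    then have "n = 0" if "x \<in> XA N A" "shiftn n x = x" for n x using bound[OF that] by simp
    then show ?thesis using that[of 1] by fastforce
  qed (use bound that in blast)
qed

lemma order_unit_birkhoff_pos:
  assumes "order_unit N A g" "x \<in> XA N A" "n > 0" "shiftn n x = x"
  shows "birkhoff g n x > 0"
proof -
  obtain m :: nat where "m > 0" "int n \<le> int m * birkhoff g n x"
    using order_unit_lower_bound[OF assms(1)] assms(2,4) by metis
  then show ?thesis using assms(3) by (smt (verit) mult_nonneg_nonpos of_nat_0_less_iff of_nat_0_le_iff)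
qed

lemma order_unit_abs_summable:
  assumes "order_unit N A g"
  obtains R where "\<And>s. Re s > R \<Longrightarrow> per_term g s abs_summable_on (Sigma {1..} (Per N A))"
proof -
  obtain m :: nat where m: "m > 0"
    "\<And>n x. x \<in> XA N A \<Longrightarrow> shiftn n x = x \<Longrightarrow> int n \<le> int m * birkhoff g n x"
    using order_unit_lower_bound[OF assms] by metis
  have "per_term g s abs_summable_on (Sigma {1..} (Per N A))"
    if "Re s > real m * ln (real (Suc N))" for s
    using per_term_abs_summable[of N A m g s] m that by (auto simp: Per_def)
  then show ?thesis using that by blast
qed

section \<open>From suspension flows to orbit maps\<close>

lemma susp_rel_sym: "(p, q) \<in> susp_rel N A l k b \<Longrightarrow> (q, p) \<in> susp_rel N A l k b"
proof -
  assume "(p, q) \<in> susp_rel N A l k b"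
  moreover have "sym ((susp_gen N A l k b \<union> (susp_gen N A l k b)\<inverse>)\<^sup>*)"
    by (intro sym_rtrancl) (auto simp: sym_def)
  ultimately show ?thesis unfolding susp_rel_def by (auto dest: symD)
qed

lemma susp_rel_trans:
  "(p, q) \<in> susp_rel N A l k b \<Longrightarrow> (q, r) \<in> susp_rel N A l k b \<Longrightarrow> (p, r) \<in> susp_rel N A l k b"
  unfolding susp_rel_def by auto

lemma susp_cls_eqI:
  "((x, r), (z, t)) \<in> susp_rel N A l k b \<Longrightarrow> susp_cls N A l k b x r = susp_cls N A l k b z t"
  unfolding susp_cls_def using susp_rel_sym susp_rel_trans by blast

lemma susp_cls_self: "(x, r) \<in> susp_dom N A b \<Longrightarrow> (x, r) \<in> susp_cls N A l k b x r"
  by (simp add: susp_cls_def susp_rel_def)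

text \<open>Translating upwards preserves the height condition of a generator, so a chain of
  identifications is moved link by link.\<close>

lemma susp_rel_translate:
  assumes "((x, r), (z, v)) \<in> susp_rel N A l k b" "t \<ge> 0"
  shows "((x, r + t), (z, v + t)) \<in> susp_rel N A l k b"
proof -
  let ?G = "susp_gen N A l k b" and ?T = "\<lambda>(x, r). (x, r + t)"
  have G: "(?T p, ?T q) \<in> ?G" if "(p, q) \<in> ?G" for p q
    using that assms(2) unfolding susp_gen_def susp_dom_def by force
  have "(?T p, ?T q) \<in> (?G \<union> ?G\<inverse>)\<^sup>*" if "(p, q) \<in> (?G \<union> ?G\<inverse>)\<^sup>*" for p q
    using that
  proof (induction rule: rtrancl_induct)
    case (step q r)
    then have "(?T q, ?T r) \<in> ?G \<union> ?G\<inverse>" using G by blast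
    then show ?case using step.IH by (rule rtrancl_into_rtrancl[rotated])
  qed simp
  from this[of "(x, r)" "(z, v)"] show ?thesis
    using assms by (auto simp: susp_rel_def susp_dom_def)
qed

lemma susp_flow_cls:
  assumes "(x, r) \<in> susp_dom N A b" "t \<ge> 0"
  shows "susp_flow N A l k b t (susp_cls N A l k b x r) = susp_cls N A l k b x (r + t)"
proof
  show "susp_flow N A l k b t (susp_cls N A l k b x r) \<subseteq> susp_cls N A l k b x (r + t)"
    unfolding susp_flow_def using susp_rel_translate[OF _ assms(2)] susp_rel_trans
    by (fastforce simp: susp_cls_def)
  show "susp_cls N A l k b x (r + t) \<subseteq> susp_flow N A l k b t (susp_cls N A l k b x r)"
    unfolding susp_flow_def using susp_cls_self[OF assms(1), of l k]
    by (force simp: susp_cls_def[of N A l k b x "r + t"])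
qed

lemma susp_cls_in_space: "(x, r) \<in> susp_dom N A b \<Longrightarrow> susp_cls N A l k b x r \<in> susp_space N A l k b"
  by (simp add: susp_cls_def susp_space_def quotientI)

text \<open>The generating identification at the lowest admissible height \<open>l x\<close> lands
  at height \<open>k x\<close>; the integrality conditions keep both heights at or above the
  base.\<close>

lemma susp_cls_glue:
  assumes "susp_triplet N A l k b" and x: "x \<in> XA N A"
  shows "susp_cls N A l k b x (l x) = susp_cls N A l k b (shift x) (k x)"
proof (rule susp_cls_eqI)
  obtain m n :: nat where "l x - b x = real m" "k x - b (shift x) = real n"
    using assms unfolding susp_triplet_def by blast
  then have dom: "(x, l x) \<in> susp_dom N A b" "(shift x, k x) \<in> susp_dom N A b"
    using x shift_in_XA by (auto simp: susp_dom_def)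
  then have "((x, l x), (shift x, l x - (l x - k x))) \<in> susp_gen N A l k b"
    unfolding susp_gen_def by blast
  then show "((x, l x), (shift x, k x)) \<in> susp_rel N A l k b"
    using dom by (auto simp: susp_rel_def)
qed

text \<open>In the standard suspension the point reached after flowing down to the base is an invariant of
  the class.\<close>

lemma standard_susp_invariant:
  assumes "(p, q) \<in> (susp_gen N A (\<lambda>_. 1) (\<lambda>_. 0) (\<lambda>_. 0) \<union> (susp_gen N A (\<lambda>_. 1) (\<lambda>_. 0) (\<lambda>_. 0))\<inverse>)\<^sup>*"
  shows "shiftn (nat \<lfloor>snd p\<rfloor>) (fst p) = shiftn (nat \<lfloor>snd q\<rfloor>) (fst q)"
proof -
  have G: "shiftn (nat \<lfloor>snd p\<rfloor>) (fst p) = shiftn (nat \<lfloor>snd q\<rfloor>) (fst q)"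
    if gen: "(p, q) \<in> susp_gen N A (\<lambda>_. 1) (\<lambda>_. 0) (\<lambda>_. 0)" for p q
  proof -
    obtain x r where pq: "p = (x, r)" "q = (shift x, r - 1)" and r: "r \<ge> 1"
      using gen by (auto simp: susp_gen_def)
    \<comment> \<open>The bound \<open>r \<ge> 1\<close> keeps \<open>nat\<close> from
      truncating.\<close>
    have "nat \<lfloor>r\<rfloor> = nat \<lfloor>r - 1\<rfloor> + 1" using r by (simp add: nat_diff_distrib le_floor_iff)
    then show ?thesis by (simp add: pq shift_eq_shiftn)
  qed
  show ?thesis
    using assms by (induction rule: rtrancl_induct) (use G in fastforce)+
qed

lemma standard_susp_cls_eqD:
  assumes "susp_cls N A (\<lambda>_. 1) (\<lambda>_. 0) (\<lambda>_. 0) x (real m) = susp_cls N A (\<lambda>_. 1) (\<lambda>_. 0) (\<lambda>_. 0) z (real n)"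
    and "z \<in> XA N A"
  shows "shiftn m x = shiftn n z"
proof -
  have "(z, real n) \<in> susp_dom N A (\<lambda>_. 0)" using assms(2) by (simp add: susp_dom_def)
  then have "(z, real n) \<in> susp_cls N A (\<lambda>_. 1) (\<lambda>_. 0) (\<lambda>_. 0) x (real m)"
    using susp_cls_self assms(1) by metis
  then show ?thesis
    using standard_susp_invariant[of "(x, real m)" "(z, real n)" N A] by (auto simp: susp_cls_def susp_rel_def)
qed

section \<open>Continuous natural exponents from the flow map\<close>

lemma continuous_map_shift: "continuous_map (XT N A) (XT N A) shift"
proof -
  have "continuous_map (product_topology (\<lambda>_. discrete_topology UNIV) UNIV) (discrete_topology UNIV)
      (\<lambda>x::nat \<Rightarrow> nat. x (Suc i))" for i
    using continuous_map_product_projection[of "Suc i" UNIV "\<lambda>_. discrete_topology (UNIV::nat set)"] by simp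
  then show ?thesis
    unfolding XT_def continuous_map_in_subtopology continuous_map_componentwise_UNIV
    using shift_in_XA by (auto simp: shift_def intro: continuous_map_from_subtopology)
qed

text \<open>As \<open>\<phi>\<close> takes only natural values, the preimage of \<open>U\<close> is
  that of the open union of balls of radius 1/2 around the members of \<open>U\<close>.\<close>

lemma Cnat_floor:
  assumes "Creal N A \<phi>" and nat: "\<And>x. x \<in> XA N A \<Longrightarrow> \<exists>m::nat. \<phi> x = real m"
  shows "Cnat N A (\<lambda>x. nat \<lfloor>\<phi> x\<rfloor>)"
  unfolding Cnat_def continuous_map_def
proof (intro conjI allI impI)
  fix U :: "nat set"
  have "open (\<Union>n\<in>U. ball (real n) (1/2))" by blast
  then have "openin (XT N A) {x \<in> topspace (XT N A). \<phi> x \<in> (\<Union>n\<in>U. ball (real n) (1/2))}"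
    using assms(1) unfolding Creal_def by (intro openin_continuous_map_preimage) auto
  moreover have "\<phi> x \<in> (\<Union>n\<in>U. ball (real n) (1/2)) \<longleftrightarrow> nat \<lfloor>\<phi> x\<rfloor> \<in> U" if x: "x \<in> XA N A" for x
  proof -
    obtain m :: nat where m: "\<phi> x = real m" using nat[OF x] by blast
    have "n = m" if near: "dist (real n) (real m) < 1/2" for n
    proof (rule ccontr)
      assume "n \<noteq> m"
      then have "real n + 1 \<le> real m \<or> real m + 1 \<le> real n" by (auto simp: nat_less_real_le neq_iff)
      then show False using near unfolding dist_real_def by linarith
    qed
    then show ?thesis using m by (auto intro!: bexI[of _ m])
  qed
  ultimately show "openin (XT N A) {x \<in> topspace (XT N A). nat \<lfloor>\<phi> x\<rfloor> \<in> U}"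
    by (smt (verit) Collect_cong topspace_XT)
qed auto

text \<open>The glued point over \<open>x\<close> lies \<open>l' x\<close> time units above the base
  point of \<open>x\<close> and \<open>k' x\<close> above that of \<open>shift x\<close>. The
  intertwining map carries this to integer heights over \<open>h x\<close> and
  \<open>h (shift x)\<close> in the standard suspension, where equal classes give equal
  shifts.\<close>

lemma flow_pair:
  assumes trip: "susp_triplet N A l k b" and h: "h ` XA N A \<subseteq> XA M B"
    and flow: "\<forall>t\<ge>0. \<forall>P\<in>susp_space N A l k b.
      \<Phi> (susp_flow N A l k b t P) = susp_flow M B (\<lambda>_. 1) (\<lambda>_. 0) (\<lambda>_. 0) t (\<Phi> P)"
    and base: "\<forall>x\<in>XA N A.
      \<Phi> (susp_cls N A l k b x (b x)) = susp_cls M B (\<lambda>_. 1) (\<lambda>_. 0) (\<lambda>_. 0) (h x) 0"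
  obtains k' l' where "Cnat N A k'" "Cnat N A l'"
    "\<forall>x\<in>XA N A. shiftn (k' x) (h (shift x)) = shiftn (l' x) (h x)"
    "\<forall>x\<in>XA N A. \<forall>p>0. shiftn p x = x \<longrightarrow>
      birkhoff (\<lambda>x. int (l' x) - int (k' x)) p x > 0"
proof -
  define l' where "l' = (\<lambda>x. nat \<lfloor>l x - b x\<rfloor>)"
  define k' where "k' = (\<lambda>x. nat \<lfloor>k x - b (shift x)\<rfloor>)"
  have ex: "\<exists>m::nat. l x - b x = real m" "\<exists>m::nat. k x - b (shift x) = real m" if "x \<in> XA N A" for x
    using trip that unfolding susp_triplet_def by blast+
  have val: "real (l' x) = l x - b x" "real (k' x) = k x - b (shift x)" if "x \<in> XA N A" for x
    using ex[OF that] by (auto simp: l'_def k'_def)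
  have cont: "Creal N A l" "Creal N A k" "Creal N A b" using trip by (auto simp: susp_triplet_def)
  have "Creal N A (\<lambda>x. l x - b x)" using cont unfolding Creal_def by (intro continuous_map_diff)
  then have Cl: "Cnat N A l'" unfolding l'_def using ex by (intro Cnat_floor)
  have "Creal N A (\<lambda>x. b (shift x))"
    using continuous_map_compose[OF continuous_map_shift cont(3)[unfolded Creal_def]]
    by (simp add: Creal_def o_def)
  then have "Creal N A (\<lambda>x. k x - b (shift x))"
    using cont unfolding Creal_def by (intro continuous_map_diff)
  then have Ck: "Cnat N A k'" unfolding k'_def using ex by (intro Cnat_floor)
  have reach: "\<Phi> (susp_cls N A l k b x (b x + real m)) = susp_cls M B (\<lambda>_. 1) (\<lambda>_. 0) (\<lambda>_. 0) (h x) (real m)"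
    if x: "x \<in> XA N A" for x m
  proof -
    have dom: "(x, b x) \<in> susp_dom N A b" "(h x, 0) \<in> susp_dom M B (\<lambda>_. 0)"
      using x h by (auto simp: susp_dom_def)
    show ?thesis
      using flow[rule_format, OF of_nat_0_le_iff susp_cls_in_space[OF dom(1)], of m] base x
      by (simp add: susp_flow_cls[OF dom(1)] susp_flow_cls[OF dom(2)])
  qed
  have orb: "shiftn (k' x) (h (shift x)) = shiftn (l' x) (h x)" if x: "x \<in> XA N A" for x
  proof -
    have sx: "shift x \<in> XA N A" using shift_in_XA[OF x] .
    have "susp_cls N A l k b (shift x) (b (shift x) + real (k' x)) = susp_cls N A l k b x (b x + real (l' x))"
      using susp_cls_glue[OF trip x] val[OF x] by simp
    then have "susp_cls M B (\<lambda>_. 1) (\<lambda>_. 0) (\<lambda>_. 0) (h (shift x)) (real (k' x)) =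
        susp_cls M B (\<lambda>_. 1) (\<lambda>_. 0) (\<lambda>_. 0) (h x) (real (l' x))"
      using reach[OF x, of "l' x"] reach[OF sx, of "k' x"] by simp
    then show ?thesis by (rule standard_susp_cls_eqD) (use h x in blast)
  qed
  obtain c where c: "order_unit N A c" "\<And>x. x \<in> XA N A \<Longrightarrow> l x - k x = of_int (c x)"
    using trip unfolding susp_triplet_def by blast
  have pos: "birkhoff (\<lambda>x. int (l' x) - int (k' x)) p x > 0"
    if x: "x \<in> XA N A" "p > 0" "shiftn p x = x" for x p
  proof -
    \<comment> \<open>On \<open>XA N A\<close>, \<open>l' - k'\<close> is \<open>c\<close> plus
      \<open>b (shift x) - b x\<close>, and the latter sums to zero over a full return to
      \<open>x\<close>.\<close>
    have tele: "(\<Sum>i<n. b (shift (shiftn i x)) - b (shiftn i x)) = b (shiftn n x) - b x" for n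
      by (induction n) (simp_all add: shiftn_Suc)
    have "real_of_int (birkhoff (\<lambda>x. int (l' x) - int (k' x)) p x) =
        (\<Sum>i<p. real (l' (shiftn i x)) - real (k' (shiftn i x)))"
      by (simp add: birkhoff_def)
    also have "\<dots> = (\<Sum>i<p. of_int (c (shiftn i x)) + (b (shift (shiftn i x)) - b (shiftn i x)))"
      using val c(2) shiftn_in_XA[OF x(1)] by (intro sum.cong) (auto simp: c(2)[symmetric])
    also have "\<dots> = of_int (birkhoff c p x)"
      using tele[of p] x(3) by (simp add: sum.distrib birkhoff_def)
    finally show ?thesis using order_unit_birkhoff_pos[OF c(1) x] by linarith
  qed
  show ?thesis using that[OF Ck Cl] orb pos by blast
qed

section \<open>The maps between cohomology groups\<close>

text \<open>The pair picked by \<open>Psi\<close> may differ from the one supplied by the flow;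
  equal differences let positivity pass between them. Adding the exponents crosswise gives two
  shifts of one point, where uniqueness applies.\<close>

lemma exponent_difference_unique:
  assumes 1: "orbit_map N A M B h k l" and 2: "orbit_map N A M B h k' l'"
    and h': "lc_to (XA M B) (XA N A) h'" "\<And>y. y \<in> XA M B \<Longrightarrow> h (h' y) = y"
      "\<And>x. x \<in> XA N A \<Longrightarrow> h' (h x) = x"
    and perf: "perfect_seqs (XA M B)" and x: "x \<in> XA N A"
  shows "int (l' x) - int (k' x) = int (l x) - int (k x)"
proof -
  interpret o1: orbit_map N A M B h k l by (rule 1)
  interpret o2: orbit_map N A M B h k' l' by (rule 2)
  \<comment> \<open>The exponents are pulled back to \<open>XA M B\<close> along \<open>h'\<close>,
    since uniqueness concerns shifts of the variable point itself.\<close>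
  have lcs: "lc (XA M B) (\<lambda>y. l (h' y) + k' (h' y))" "lc (XA M B) (\<lambda>y. l' (h' y) + k (h' y))"
    by (intro lc_map2[where F = "(+)"] lc_comp[OF _ h'(1)] o1.k_lc o1.l_lc o2.k_lc o2.l_lc)+
  have "shiftn (l (h' y) + k' (h' y)) y = shiftn (l' (h' y) + k (h' y)) y" if y: "y \<in> XA M B" for y
  proof -
    let ?x = "h' y"
    have x: "?x \<in> XA N A" using h'(1) y by (auto simp: lc_to_def)
    have "shiftn (l ?x + k' ?x) y = shiftn (k' ?x) (shiftn (k ?x) (h (shift ?x)))"
      using o1.orbit_eq[OF x] h'(2)[OF y] by (simp add: add.commute)
    also have "\<dots> = shiftn (k ?x) (shiftn (k' ?x) (h (shift ?x)))" by (simp add: add.commute)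
    also have "\<dots> = shiftn (k ?x) (shiftn (l' ?x) (h ?x))" unfolding o2.orbit_eq[OF x] ..
    finally show ?thesis using h'(2)[OF y] by (simp add: add.commute)
  qed
  then have "l (h' (h x)) + k' (h' (h x)) = l' (h' (h x)) + k (h' (h x))"
    using exponents_unique[OF perf lcs, of "h x"] o1.map_in[OF x] by blast
  then show ?thesis using h'(3)[OF x] by simp
qed

text \<open>The existence of one admissible pair makes the pair selected inside \<open>Psi\<close>
  admissible too.\<close>

lemma Psi_eq_cocycle:
  assumes "Cnat N A k" "Cnat N A l"
    and "\<forall>x\<in>XA N A. shiftn (k x) (h (shift x)) = shiftn (l x) (h x)"
    and h: "lc_to (XA N A) (XA M B) h"
  obtains k' l' where "orbit_map N A M B h k' l'" "\<And>f. Psi N A M B h f = cocycle h k' l' f"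
proof -
  let ?P = "\<lambda>kl. Cnat N A (fst kl) \<and> Cnat N A (snd kl) \<and>
    (\<forall>x\<in>XA N A. shiftn (fst kl x) (h (shift x)) = shiftn (snd kl x) (h x))"
  define kl where "kl = (SOME kl. ?P kl)"
  have "?P (k, l)" using assms by simp
  then have P: "?P kl" unfolding kl_def by (rule someI[of ?P])
  show ?thesis
  proof (rule that[of "fst kl" "snd kl"])
    show "orbit_map N A M B h (fst kl) (snd kl)"
      using P h by unfold_locales (auto simp: Cnat_def intro: lc_if_continuous)
    show "Psi N A M B h f = cocycle h (fst kl) (snd kl) f" for f
      by (rule ext) (simp add: Psi_def cocycle_def birkhoff_def kl_def Let_def)
  qed
qed

section \<open>Assembling the orbit equivalence and the zeta identities\<close>

lemma inv_into_homeomorphism: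
  assumes "homeomorphic_map (XT N A) (XT M B) h"
  defines "h' \<equiv> inv_into (XA N A) h"
  shows "lc_to (XA N A) (XA M B) h" "lc_to (XA M B) (XA N A) h'"
    "\<And>x. x \<in> XA N A \<Longrightarrow> h' (h x) = x" "\<And>y. y \<in> XA M B \<Longrightarrow> h (h' y) = y"
proof -
  obtain g where g: "homeomorphic_maps (XT N A) (XT M B) h g"
    using assms(1) homeomorphic_map_maps by blast
  then have cont: "continuous_map (XT N A) (XT M B) h" "continuous_map (XT M B) (XT N A) g"
    and inv: "\<And>x. x \<in> XA N A \<Longrightarrow> g (h x) = x" "\<And>y. y \<in> XA M B \<Longrightarrow> h (g y) = y"
    by (auto simp: homeomorphic_maps_def)
  show lch: "lc_to (XA N A) (XA M B) h" by (rule lc_to_if_continuous[OF cont(1)])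
  have lcg: "lc_to (XA M B) (XA N A) g" by (rule lc_to_if_continuous[OF cont(2)])
  have inj: "inj_on h (XA N A)" using inv(1) by (metis inj_onI)
  \<comment> \<open>On \<open>XA M B\<close> the set-theoretic inverse is the continuous one, from
    which it takes its continuity.\<close>
  have eq: "h' y = g y" if "y \<in> XA M B" for y
  proof -
    have "g y \<in> XA N A" using lcg that by (auto simp: lc_to_def)
    then show ?thesis unfolding h'_def using inv_into_f_eq[OF inj] inv(2)[OF that] by blast
  qed
  show "lc_to (XA M B) (XA N A) h'"
    using lc_to_if_continuous continuous_map_eq[OF cont(2), of h'] eq by simp
  show "h' (h x) = x" if "x \<in> XA N A" for x
    using that inj by (simp add: h'_def)
  show "h (h' y) = y" if "y \<in> XA M B" for y
    using eq inv(2) that by simp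
qed

lemma flow_equivalence_orbit_equivalence:
  assumes A: "zero_one_matrix N A" "irreducible_matrix N A" "\<not> permutation_matrix N A"
    and B: "zero_one_matrix M B" "irreducible_matrix M B" "\<not> permutation_matrix M B"
    and "flow_equiv_via N A M B h"
  defines "h' \<equiv> inv_into (XA N A) h"
  obtains k l k' l' where "orbit_equivalence N A M B h k l h' k' l'"
    "\<And>f. Psi N A M B h f = cocycle h k l f" "\<And>g. Psi M B N A h' g = cocycle h' k' l' g"
proof -
  from \<open>flow_equiv_via N A M B h\<close> obtain l1 k1 b1 l2 k2 b2 \<Phi>1 \<Phi>2 where
    hom: "homeomorphic_map (XT N A) (XT M B) h"
    and trip: "susp_triplet N A l1 k1 b1" "susp_triplet M B l2 k2 b2"
    and flow1: "\<forall>t\<ge>0. \<forall>P\<in>susp_space N A l1 k1 b1.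
           \<Phi>1 (susp_flow N A l1 k1 b1 t P) = susp_flow M B (\<lambda>_. 1) (\<lambda>_. 0) (\<lambda>_. 0) t (\<Phi>1 P)"
    and flow2: "\<forall>t\<ge>0. \<forall>P\<in>susp_space M B l2 k2 b2.
           \<Phi>2 (susp_flow M B l2 k2 b2 t P) = susp_flow N A (\<lambda>_. 1) (\<lambda>_. 0) (\<lambda>_. 0) t (\<Phi>2 P)"
    and base1: "\<forall>x\<in>XA N A. \<Phi>1 (susp_cls N A l1 k1 b1 x (b1 x))
            = susp_cls M B (\<lambda>_. 1) (\<lambda>_. 0) (\<lambda>_. 0) (h x) 0"
    and base2: "\<forall>y\<in>XA M B. \<Phi>2 (susp_cls M B l2 k2 b2 y (b2 y))
            = susp_cls N A (\<lambda>_. 1) (\<lambda>_. 0) (\<lambda>_. 0) (h' y) 0"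
    unfolding flow_equiv_via_def h'_def[symmetric] by (elim conjE exE) (rule that)
  note inv = inv_into_homeomorphism[OF hom, folded h'_def]
  have into: "h ` XA N A \<subseteq> XA M B" "h' ` XA M B \<subseteq> XA N A"
    using inv(1,2) by (auto simp: lc_to_def)
  note perf = perfect_XA[OF A] perfect_XA[OF B]
  obtain c d where cd: "Cnat N A c" "Cnat N A d"
    "\<forall>x\<in>XA N A. shiftn (c x) (h (shift x)) = shiftn (d x) (h x)"
    and pos: "\<forall>x\<in>XA N A. \<forall>p>0. shiftn p x = x \<longrightarrow>
      birkhoff (\<lambda>x. int (d x) - int (c x)) p x > 0"
    using flow_pair[OF trip(1) into(1) flow1 base1] .
  obtain c' d' where cd': "Cnat M B c'" "Cnat M B d'"
    "\<forall>y\<in>XA M B. shiftn (c' y) (h' (shift y)) = shiftn (d' y) (h' y)"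
    and pos': "\<forall>y\<in>XA M B. \<forall>p>0. shiftn p y = y \<longrightarrow>
      birkhoff (\<lambda>y. int (d' y) - int (c' y)) p y > 0"
    using flow_pair[OF trip(2) into(2) flow2 base2] .
  obtain k l where kl: "orbit_map N A M B h k l" and Psi: "\<And>f. Psi N A M B h f = cocycle h k l f"
    by (rule Psi_eq_cocycle[OF cd inv(1)]) (rule that)
  obtain k' l' where kl': "orbit_map M B N A h' k' l'" and Psi': "\<And>f. Psi M B N A h' f = cocycle h' k' l' f"
    by (rule Psi_eq_cocycle[OF cd' inv(2)]) (rule that)
  \<comment> \<open>Positivity is known for the exponents of the flow; it is carried to the pairs
    used by \<open>Psi\<close>, whose differences are the same.\<close>
  have "orbit_map N A M B h c d" "orbit_map M B N A h' c' d'"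
    using cd cd' inv(1,2) by (unfold_locales; auto simp: Cnat_def intro: lc_if_continuous)+
  then have "int (l x) - int (k x) = int (d x) - int (c x)" if "x \<in> XA N A" for x
    using exponent_difference_unique[OF _ kl inv(2,4,3) perf(2) that] by blast
  then have "birkhoff (\<lambda>x. int (l x) - int (k x)) p x > 0" if "x \<in> XA N A" "p > 0" "shiftn p x = x" for x p
    using birkhoff_cong[of N A "\<lambda>x. int (l x) - int (k x)" "\<lambda>x. int (d x) - int (c x)"] pos that by simp
  moreover have "int (l' y) - int (k' y) = int (d' y) - int (c' y)" if "y \<in> XA M B" for y
    using exponent_difference_unique[OF \<open>orbit_map M B N A h' c' d'\<close> kl' inv(1,3,4) perf(1) that] .
  then have "birkhoff (\<lambda>y. int (l' y) - int (k' y)) p y > 0" if "y \<in> XA M B" "p > 0" "shiftn p y = y" for y p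
    using birkhoff_cong[of M B "\<lambda>y. int (l' y) - int (k' y)" "\<lambda>y. int (d' y) - int (c' y)"] pos' that by simp
  ultimately have "orbit_equivalence N A M B h k l h' k' l'"
    using kl kl' inv(3,4) perf by (auto simp: orbit_equivalence_def orbit_equivalence_axioms_def)
  then show ?thesis using that Psi Psi' by blast
qed

text \<open>The threshold \<open>R\<close> comes from \<open>f\<close>; the series of the cocycle
  converges by transfer along the orbit bijection.\<close>

lemma (in orbit_equivalence) zeta_order_unit:
  assumes "order_unit M B f"
  shows "\<exists>R. \<forall>s. Re s > R \<longrightarrow> summable (zeta_term M B f s) \<and>
    summable (zeta_term N A (cocycle h k l f) s) \<and> zeta M B f s = zeta N A (cocycle h k l f) s"
proof -
  obtain R where R: "\<And>s. Re s > R \<Longrightarrow> per_term f s abs_summable_on (Sigma {1..} (Per M B))"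
    using order_unit_abs_summable[OF assms] by blast
  show ?thesis
    using zeta_cocycle[OF _ R] by (intro exI[of _ R]) auto
qed

theorem theorem4p6:
  fixes N M :: nat and A B :: "nat \<Rightarrow> nat \<Rightarrow> nat"
    and h :: "(nat \<Rightarrow> nat) \<Rightarrow> (nat \<Rightarrow> nat)"
    and f g :: "(nat \<Rightarrow> nat) \<Rightarrow> int"
  assumes "N > 1" "M > 1"
    and "zero_one_matrix N A" "irreducible_matrix N A" "\<not> permutation_matrix N A"
    and "zero_one_matrix M B" "irreducible_matrix M B" "\<not> permutation_matrix M B"
    and "flow_equiv_via N A M B h"
    and "order_unit M B f" and "order_unit N A g"
  shows "(\<exists>R. \<forall>s. Re s > R \<longrightarrow>
           summable (zeta_term N A g s) \<and>
           summable (zeta_term M B (Psi M B N A (inv_into (XA N A) h) g) s) \<and>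
           zeta N A g s = zeta M B (Psi M B N A (inv_into (XA N A) h) g) s) \<and>
         (\<exists>R. \<forall>s. Re s > R \<longrightarrow>
           summable (zeta_term M B f s) \<and>
           summable (zeta_term N A (Psi N A M B h f) s) \<and>
           zeta M B f s = zeta N A (Psi N A M B h f) s)"
proof -
  let ?h' = "inv_into (XA N A) h"
  obtain k l k' l' where oe: "orbit_equivalence N A M B h k l ?h' k' l'"
    and Psi: "\<And>f. Psi N A M B h f = cocycle h k l f"
    and Psi': "\<And>g. Psi M B N A ?h' g = cocycle ?h' k' l' g"
    by (rule flow_equivalence_orbit_equivalence[OF assms(3-9)]) (rule that)
  show ?thesis
    unfolding Psi Psi'
    using orbit_equivalence.zeta_order_unit[OF orbit_equivalence.orbit_equivalence_swap[OF oe] assms(11)]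
      orbit_equivalence.zeta_order_unit[OF oe assms(10)] by simp
qed

end
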